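(* Let $n\ge 4$. The number $|G(n,n-4)/Z_n|$ of cyclic equivalence classes of $(n-4)$-dissections (almost-triangulations) of a convex regular $n$-gon is \[ \frac{n-3}{2n}C_{n-2}+\frac{1}{2}C_{n/4-1}+\frac{1}{4}C_{n/2-1}. \]
   Context: For $n\ge 3$ and $0\le k\le n-3$, a $k$-dissection of a convex regular $n$-gon is a partition of it into $k+1$ polygons by $k$ pairwise non-crossing diagonals; $G(n,k)$ denotes the set of $k$-dissections (with vertices labelled $0,\dots,n-1$ in cyclic order, so dissections are distinct sets of diagonals). The cyclic group $Z_n$ acts on $G(n,k)$ by rotating the polygon (vertex $v\mapsto v+1 \bmod n$), and $G(n,k)/Z_n$ is the set of orbits. For a real number $m$, $C_m=\frac{1}{m+1}\binom{2m}{m}$ if $m$ is a nonnegative integer, and $C_m=0$ otherwise. (Equivalently, the count is the number of edges of the $(n-3)$-dimensional associahedron modulo the cyclic action.) *)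

theory Defs
  imports Complex_Main "HOL-Algebra.Group_Action" "HOL-Algebra.Elementary_Groups"
begin

text \<open>The vertices of the polygon are labelled by the integers \<open>0, \<dots>, n - 1\<close> in cyclic order.
  A diagonal is identified with the set of its two (distinct, non-adjacent) endpoints.\<close>

definition diagonals :: "nat \<Rightarrow> int set set" where
  "diagonals n = {{a, b} | a b. a \<in> {0..<int n} \<and> b \<in> {0..<int n} \<and> a \<noteq> b \<and>
     b \<noteq> (a + 1) mod int n \<and> a \<noteq> (b + 1) mod int n}"

text \<open>Two chords of a convex polygon meet in their relative interiors, without overlapping,
  iff their endpoints strictly alternate along the boundary.\<close>

definition crosses :: "int set \<Rightarrow> int set \<Rightarrow> bool" where
  "crosses d e \<longleftrightarrow> (\<exists>p q r s. p < q \<and> q < r \<and> r < s \<and>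
     (d = {p, r} \<and> e = {q, s} \<or> d = {q, s} \<and> e = {p, r}))"

definition dissections :: "nat \<Rightarrow> nat \<Rightarrow> int set set set" where
  "dissections n k =
     {D. D \<subseteq> diagonals n \<and> card D = k \<and> (\<forall>d\<in>D. \<forall>e\<in>D. \<not> crosses d e)}"

definition rotate_vertex :: "nat \<Rightarrow> int \<Rightarrow> int \<Rightarrow> int" where
  "rotate_vertex n g v = (v + g) mod int n"

text \<open>The restriction to \<open>dissections n k\<close> is what the library's \<open>group_action\<close>
  requires of an action.\<close>

definition rotation :: "nat \<Rightarrow> nat \<Rightarrow> int \<Rightarrow> int set set \<Rightarrow> int set set" where
  "rotation n k g = (\<lambda>D\<in>dissections n k. (\<lambda>d. rotate_vertex n g ` d) ` D)"

definition dissection_classes :: "nat \<Rightarrow> nat \<Rightarrow> int set set set set" where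
  "dissection_classes n k =
     orbits (integer_mod_group n) (dissections n k) (rotation n k)"

definition catalan :: "real \<Rightarrow> real" where
  "catalan m = (if m \<in> \<nat>
     then 1 / (m + 1) * real ((2 * nat \<lfloor>m\<rfloor>) choose nat \<lfloor>m\<rfloor>) else 0)"

lemma rotate_vertex_cases:
  assumes "v \<in> {0..<int n}" "g \<in> {0..<int n}"
  shows "rotate_vertex n g v = (if v + g < int n then v + g else v + g - int n)"
proof (cases "v + g < int n")
  case True
  then show ?thesis using assms by (simp add: rotate_vertex_def)
next
  case False
  then have "(v + g) mod int n = (v + g - int n) mod int n" by simp
  also have "\<dots> = v + g - int n" using assms False by (intro mod_pos_pos_trivial) auto
  finally show ?thesis using False by (simp add: rotate_vertex_def)
qed

lemma rotate_vertex_in: "n > 0 \<Longrightarrow> rotate_vertex n g v \<in> {0..<int n}"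
  by (simp add: rotate_vertex_def)

lemma rotate_vertex_add:
  "rotate_vertex n g (rotate_vertex n h v) = rotate_vertex n ((g + h) mod int n) v"
  by (simp add: rotate_vertex_def mod_simps add.commute add.left_commute)

lemma rotate_vertex_0: "v \<in> {0..<int n} \<Longrightarrow> rotate_vertex n 0 v = v"
  by (simp add: rotate_vertex_def)

lemma diagonals_subset: "d \<in> diagonals n \<Longrightarrow> d \<subseteq> {0..<int n}"
  by (auto simp: diagonals_def)

lemma rotate_vertex_Suc:
  "rotate_vertex n g ((a + 1) mod int n) = (rotate_vertex n g a + 1) mod int n"
  by (simp add: rotate_vertex_def mod_simps algebra_simps)

lemma rotate_vertex_inj:
  assumes "n > 0" "a \<in> {0..<int n}" "b \<in> {0..<int n}"
    "rotate_vertex n g a = rotate_vertex n g b"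
  shows "a = b"
proof -
  have "rotate_vertex n (- g) (rotate_vertex n g c) = c" if "c \<in> {0..<int n}" for c
    using that by (simp add: rotate_vertex_def mod_simps)
  then show ?thesis using assms by metis
qed

lemma rotate_diagonal:
  assumes "n > 0" "d \<in> diagonals n"
  shows "rotate_vertex n g ` d \<in> diagonals n"
proof -
  from assms(2) obtain a b where d: "d = {a, b}" and ab: "a \<in> {0..<int n}" "b \<in> {0..<int n}"
    "a \<noteq> b" "b \<noteq> (a + 1) mod int n" "a \<noteq> (b + 1) mod int n"
    unfolding diagonals_def by blast
  have "(c + 1) mod int n \<in> {0..<int n}" for c using assms(1) by simp
  then have "rotate_vertex n g a \<noteq> rotate_vertex n g b"
    "rotate_vertex n g b \<noteq> (rotate_vertex n g a + 1) mod int n"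
    "rotate_vertex n g a \<noteq> (rotate_vertex n g b + 1) mod int n"
    using rotate_vertex_inj[OF assms(1)] ab rotate_vertex_Suc by metis+
  then show ?thesis unfolding diagonals_def d using rotate_vertex_in[OF assms(1)] by auto
qed

lemma crosses_sym: "crosses d e \<longleftrightarrow> crosses e d"
  unfolding crosses_def by blast

lemma crossesI: "p < q \<Longrightarrow> q < r \<Longrightarrow> r < s \<Longrightarrow> crosses {p, r} {q, s}"
  unfolding crosses_def by blast

lemma crosses_rotate_aux:
  assumes "{p, q, r, s} \<subseteq> {0..<int n}" "g \<in> {0..<int n}" "p < q" "q < r" "r < s"
  shows "crosses (rotate_vertex n g ` {p, r}) (rotate_vertex n g ` {q, s})"
proof -
  let ?f = "rotate_vertex n g"
  have f: "?f x = (if x + g < int n then x + g else x + g - int n)" if "x \<in> {p, q, r, s}" for x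
    using rotate_vertex_cases that assms by blast
  have "?f p < ?f q \<and> ?f q < ?f r \<and> ?f r < ?f s \<or>
        ?f q < ?f r \<and> ?f r < ?f s \<and> ?f s < ?f p \<or>
        ?f r < ?f s \<and> ?f s < ?f p \<and> ?f p < ?f q \<or>
        ?f s < ?f p \<and> ?f p < ?f q \<and> ?f q < ?f r"
    using assms f[of p] f[of q] f[of r] f[of s] by (auto split: if_splits)
  then show ?thesis
    using crossesI[of "?f p" "?f q" "?f r" "?f s"] crossesI[of "?f q" "?f r" "?f s" "?f p"]
      crossesI[of "?f r" "?f s" "?f p" "?f q"] crossesI[of "?f s" "?f p" "?f q" "?f r"]
    by (auto simp: insert_commute crosses_sym)
qed

lemma crosses_rotate:
  assumes "d \<subseteq> {0..<int n}" "e \<subseteq> {0..<int n}" "g \<in> {0..<int n}" "crosses d e"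
  shows "crosses (rotate_vertex n g ` d) (rotate_vertex n g ` e)"
proof -
  from assms(4) obtain p q r s where *: "p < q" "q < r" "r < s"
    and de: "d = {p, r} \<and> e = {q, s} \<or> d = {q, s} \<and> e = {p, r}"
    unfolding crosses_def by blast
  then have "{p, q, r, s} \<subseteq> {0..<int n}" using assms(1,2) by auto
  from crosses_rotate_aux[OF this assms(3) *] show ?thesis using de crosses_sym by metis
qed

lemma rotate_set_add:
  "(\<lambda>d. rotate_vertex n g ` d) ` (\<lambda>d. rotate_vertex n h ` d) ` D =
     (\<lambda>d. rotate_vertex n ((g + h) mod int n) ` d) ` D"
  by (simp add: image_image rotate_vertex_add)

lemma rotate_set_0:
  assumes "D \<subseteq> diagonals n"
  shows "(\<lambda>d. rotate_vertex n 0 ` d) ` D = D"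
proof -
  have "rotate_vertex n 0 ` d = d" if "d \<in> D" for d
  proof -
    have "\<And>v. v \<in> d \<Longrightarrow> rotate_vertex n 0 v = v"
      using diagonals_subset[of d n] that assms rotate_vertex_0 by blast
    then show ?thesis by force
  qed
  then show ?thesis by force
qed

lemma rotate_dissection:
  assumes n: "n > 0" and g: "g \<in> {0..<int n}" and D: "D \<in> dissections n k"
  shows "(\<lambda>d. rotate_vertex n g ` d) ` D \<in> dissections n k"
proof -
  let ?R = "\<lambda>g d. rotate_vertex n g ` d"
  let ?h = "(- g) mod int n"
  have h: "?h \<in> {0..<int n}" using n by simp
  have hg: "(?h + g) mod int n = 0" by (simp add: mod_simps)
  have sub: "D \<subseteq> diagonals n" using D by (simp add: dissections_def)
  have undo_rot: "?R ?h (?R g d) = d" if "d \<in> D" for d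
  proof -
    have "?R ?h (?R g d) = ?R 0 d" by (simp only: image_image rotate_vertex_add hg)
    also have "\<dots> = d" using rotate_set_0[of "{d}" n] that sub by auto
    finally show ?thesis .
  qed
  have "inj_on (?R g) D" by (metis undo_rot inj_onI)
  moreover have "?R g ` D \<subseteq> diagonals n" using rotate_diagonal[OF n] sub by blast
  moreover have "\<not> crosses (?R g d) (?R g e)" if de: "d \<in> D" "e \<in> D" for d e
  proof
    assume c: "crosses (?R g d) (?R g e)"
    have "?R g d \<subseteq> {0..<int n}" "?R g e \<subseteq> {0..<int n}"
      using rotate_vertex_in[OF n] by blast+
    from crosses_rotate[OF this h c] have "crosses d e" using undo_rot de by simp
    then show False using D de by (auto simp: dissections_def)
  qed
  ultimately show ?thesis using D by (auto simp: dissections_def card_image)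
qed

lemma rotation_group_action:
  assumes n: "n > 0"
  shows "group_action (integer_mod_group n) (dissections n k) (rotation n k)"
proof -
  let ?E = "dissections n k"
  let ?R = "\<lambda>g D. (\<lambda>d. rotate_vertex n g ` d) ` D"
  have carr: "carrier (integer_mod_group n) = {0..<int n}"
    using n by (simp add: carrier_integer_mod_group)
  have inv: "?R g (?R h D) = D" if "D \<in> ?E" "(g + h) mod int n = 0" for g h D
    using that rotate_set_add[of n g h D] rotate_set_0[of D n] by (simp add: dissections_def)
  have bij: "rotation n k g \<in> Bij ?E" if g: "g \<in> {0..<int n}" for g
  proof -
    let ?h = "(- g) mod int n"
    have h: "?h \<in> {0..<int n}" using n by simp
    have "bij_betw (?R g) ?E ?E"
      by (rule bij_betw_byWitness[where f' = "?R ?h"])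
        (use rotate_dissection[OF n g] rotate_dissection[OF n h] inv in
          \<open>auto simp: mod_simps image_subset_iff\<close>)
    then show ?thesis
      unfolding Bij_def rotation_def by (simp cong: bij_betw_cong)
  qed
  have "rotation n k ((g + h) mod int n) = compose ?E (rotation n k g) (rotation n k h)"
    if "g \<in> {0..<int n}" "h \<in> {0..<int n}" for g h
    using rotate_dissection[OF n that(2)] rotate_set_add[of n g h]
    by (auto simp: rotation_def compose_def restrict_def fun_eq_iff)
  then have "rotation n k \<in> hom (integer_mod_group n) (BijGroup ?E)"
    using bij by (auto simp: hom_def carr BijGroup_def)
  then show ?thesis
    by (simp add: group_action_def group_hom_def group_hom_axioms_def group_BijGroup)
qed

end

theory Submission
  imports Defs "HOL-Computational_Algebra.Formal_Power_Series"
begin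

text \<open>
  An almost-triangulation \<open>D\<close> has a single quadrilateral cell, so exactly two diagonals can be added
  to it, and these two cross. Counting pairs \<open>(D, e)\<close> with \<open>e\<close> addable to \<open>D\<close> relates the
  almost-triangulations to the triangulations. By Burnside's lemma it remains to count the fixed
  points of each rotation. A rotation fixing \<open>D\<close> permutes the four corners of the quadrilateral,
  hence has order 1, 2 or 4. If the order is 2 or 4, the half-turn also fixes \<open>D\<close>, so the two
  addable diagonals are diameters, and counting pairs of \<open>D\<close> and an addable diameter reduces to the
  \<open>D\<close> with a prescribed addable diameter. Such a \<open>D\<close> is the union of the rotated copies of a
  triangulation of one of the 2 or 4 sectors of the polygon.
\<close>

section \<open>Noncrossing families of arcs\<close>

text \<open>An arc is a pair \<open>(x, y)\<close> with \<open>x < y\<close>; it stands for the chord \<open>{x, y}\<close>.\<close>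

definition crossing :: "int \<times> int \<Rightarrow> int \<times> int \<Rightarrow> bool" where
  "crossing s t \<longleftrightarrow> fst s < fst t \<and> fst t < snd s \<and> snd s < snd t"

definition noncrossing :: "(int \<times> int) set \<Rightarrow> bool" where
  "noncrossing S \<longleftrightarrow> (\<forall>s\<in>S. \<forall>t\<in>S. \<not> crossing s t)"

definition arcs :: "int \<Rightarrow> int \<Rightarrow> (int \<times> int) set" where
  "arcs a b = {(x, y). a \<le> x \<and> x < y \<and> y \<le> b}"

definition unit_arcs :: "int \<Rightarrow> int \<Rightarrow> (int \<times> int) set" where
  "unit_arcs a b = {(x, y). a \<le> x \<and> x < b \<and> y = x + 1}"

definition sides :: "int \<Rightarrow> int \<Rightarrow> (int \<times> int) set" where
  "sides a b = insert (a, b) (unit_arcs a b)"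

lemma crossing_pair [simp]: "crossing (x, y) (u, v) \<longleftrightarrow> x < u \<and> u < y \<and> y < v"
  by (simp add: crossing_def)

lemma arcs_iff [simp]: "(x, y) \<in> arcs a b \<longleftrightarrow> a \<le> x \<and> x < y \<and> y \<le> b"
  by (simp add: arcs_def)

lemma unit_arcs_iff [simp]: "(x, y) \<in> unit_arcs a b \<longleftrightarrow> a \<le> x \<and> x < b \<and> y = x + 1"
  by (simp add: unit_arcs_def)

lemma finite_arcs [simp]: "finite (arcs a b)"
  by (rule finite_subset[of _ "{a..b} \<times> {a..b}"]) (auto simp: arcs_def)

lemma finite_subset_arcs: "S \<subseteq> arcs a b \<Longrightarrow> finite S"
  using finite_subset finite_arcs by blast

lemma sides_subset_arcs: "a < b \<Longrightarrow> sides a b \<subseteq> arcs a b"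
  by (auto simp: sides_def)

lemma card_unit_arcs: "card (unit_arcs a b) = nat (b - a)"
proof -
  have "unit_arcs a b = (\<lambda>x. (x, x + 1)) ` {a..<b}" by auto
  then show ?thesis by (simp add: card_image inj_on_def)
qed

lemma card_sides:
  assumes "a + 1 < b"
  shows "int (card (sides a b)) = b - a + 1"
proof -
  have "unit_arcs a b \<subseteq> arcs a b" by auto
  then have "(a, b) \<notin> unit_arcs a b" "finite (unit_arcs a b)"
    using assms finite_subset_arcs by auto
  then show ?thesis using assms by (simp add: sides_def card_unit_arcs)
qed

lemma noncrossingD:
  "noncrossing S \<Longrightarrow> (x, y) \<in> S \<Longrightarrow> (u, v) \<in> S \<Longrightarrow> x < u \<Longrightarrow> u < y \<Longrightarrow> v \<le> y"
  unfolding noncrossing_def by force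

lemma noncrossing_subset: "noncrossing T \<Longrightarrow> S \<subseteq> T \<Longrightarrow> noncrossing S"
  unfolding noncrossing_def by blast

lemma noncrossing_insert:
  "noncrossing (insert t S) \<longleftrightarrow>
     noncrossing S \<and> (\<forall>s\<in>S. \<not> crossing s t \<and> \<not> crossing t s)"
  unfolding noncrossing_def crossing_def by auto

lemma not_crossing_arcs_disjoint:
  assumes "s \<in> arcs a c" "t \<in> arcs c b"
  shows "\<not> crossing s t" "\<not> crossing t s"
  using assms by (cases s; cases t; simp)+

lemma not_crossing_side:
  assumes "s \<in> arcs a b \<union> sides a b" "t \<in> sides a b"
  shows "\<not> crossing s t" "\<not> crossing t s"
  using assms by (cases s; cases t; auto simp: sides_def)+

lemma noncrossing_Un_sides:
  assumes "S \<subseteq> arcs a b"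
  shows "noncrossing (S \<union> sides a b) \<longleftrightarrow> noncrossing S"
  using assms not_crossing_side unfolding noncrossing_def by blast

section \<open>Subdivisions and triangulations of a polygon\<close>

text \<open>The polygon has the vertices \<open>a, \<dots>, b\<close>, and its sides count as members of a subdivision. A
  triangulation thus has \<open>b - a + 1\<close> sides and \<open>b - a - 2\<close> diagonals. For \<open>b = a + 1\<close> the polygon
  degenerates to the single arc \<open>(a, b)\<close>.\<close>

definition subdivisions :: "int \<Rightarrow> int \<Rightarrow> (int \<times> int) set set" where
  "subdivisions a b = {S. sides a b \<subseteq> S \<and> S \<subseteq> arcs a b \<and> noncrossing S}"

definition triangulations :: "int \<Rightarrow> int \<Rightarrow> (int \<times> int) set set" where
  "triangulations a b = {S \<in> subdivisions a b. int (card S) = 2 * (b - a) - 1}"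

definition glue :: "int \<Rightarrow> int \<Rightarrow> (int \<times> int) set \<Rightarrow> (int \<times> int) set \<Rightarrow> (int \<times> int) set" where
  "glue a b S T = insert (a, b) (S \<union> T)"

lemma subdivisionsD:
  assumes "S \<in> subdivisions a b"
  shows "S \<subseteq> arcs a b" "noncrossing S" "(a, b) \<in> S" "unit_arcs a b \<subseteq> S" "a < b" "finite S"
  using assms finite_subset_arcs[of S a b] by (auto simp: subdivisions_def sides_def)

lemma triangulationsD:
  assumes "S \<in> triangulations a b"
  shows "S \<in> subdivisions a b" "int (card S) = 2 * (b - a) - 1"
  using assms by (simp_all add: triangulations_def)

lemma finite_triangulations [simp]: "finite (triangulations a b)"
  by (rule finite_subset[of _ "Pow (arcs a b)"]) (auto simp: triangulations_def subdivisions_def)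

lemma subdivisions_Un_sides:
  assumes "S \<subseteq> arcs a b" "noncrossing S" "a < b"
  shows "S \<union> sides a b \<in> subdivisions a b"
  using assms sides_subset_arcs noncrossing_Un_sides by (simp add: subdivisions_def)

lemma subdivisions_insert:
  assumes "S \<in> subdivisions a b" "t \<in> arcs a b" "noncrossing (insert t S)"
  shows "insert t S \<in> subdivisions a b"
  using assms by (auto simp: subdivisions_def)

lemma glue_subdivisions:
  assumes "S \<in> subdivisions a c" "T \<in> subdivisions c b"
  shows "glue a b S T \<in> subdivisions a b"
proof -
  note left = subdivisionsD[OF assms(1)] and right = subdivisionsD[OF assms(2)]
  have "noncrossing (S \<union> T)"
    using left(1,2) right(1,2) not_crossing_arcs_disjoint unfolding noncrossing_def by blast
  moreover have "S \<union> T \<subseteq> arcs a b" using left(1,5) right(1,5) by force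
  moreover have "unit_arcs a b \<subseteq> unit_arcs a c \<union> unit_arcs c b" by auto
  then have "glue a b S T = S \<union> T \<union> sides a b"
    using left(4) right(4) unfolding glue_def sides_def by blast
  ultimately show ?thesis using subdivisions_Un_sides[of "S \<union> T" a b] left(5) right(5) by simp
qed

lemma card_glue:
  assumes "S \<in> subdivisions a c" "T \<in> subdivisions c b"
  shows "card (glue a b S T) = 1 + card S + card T"
proof -
  note left = subdivisionsD[OF assms(1)] and right = subdivisionsD[OF assms(2)]
  have "S \<inter> T = {}" "(a, b) \<notin> S \<union> T" using left(1,5) right(1,5) by force+
  then show ?thesis using left(6) right(6) by (simp add: glue_def card_Un_disjoint)
qed

lemma card_open_glue:
  assumes "S \<in> subdivisions a c" "T \<in> subdivisions c b"
  shows "card (glue a b S T - {(c, b)}) = card S + card T"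
proof -
  have "(c, b) \<in> glue a b S T" using subdivisionsD(3)[OF assms(2)] by (simp add: glue_def)
  then show ?thesis
    using card_glue[OF assms] subdivisionsD(6)[OF glue_subdivisions[OF assms]]
    by (simp add: card_Diff_singleton)
qed

lemma glue_Int_arcs:
  assumes "S \<in> subdivisions a c" "T \<in> subdivisions c b"
  shows "glue a b S T \<inter> arcs a c = S" "glue a b S T \<inter> arcs c b = T"
  using subdivisionsD(1,5)[OF assms(1)] subdivisionsD(1,5)[OF assms(2)]
  by (force simp: glue_def)+

lemma glue_apex_unique:
  assumes "S \<in> subdivisions a c" "T \<in> subdivisions c b"
    and "S' \<in> subdivisions a c'" "T' \<in> subdivisions c' b"
    and "glue a b S T = glue a b S' T'"
  shows "c = c'"
proof (rule linorder_cases)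
  have noncrossing: "noncrossing (glue a b S T)"
    using glue_subdivisions[OF assms(1,2)] by (rule subdivisionsD)
  have "(a, c) \<in> glue a b S T" "(c, b) \<in> glue a b S T"
    using assms(1,2)[THEN subdivisionsD(3)] by (simp_all add: glue_def)
  moreover have "(a, c') \<in> glue a b S' T'" "(c', b) \<in> glue a b S' T'"
    using assms(3,4)[THEN subdivisionsD(3)] by (simp_all add: glue_def)
  ultimately have apex_arcs: "{(a, c), (c, b), (a, c'), (c', b)} \<subseteq> glue a b S T"
    unfolding assms(5) by simp
  have bounds: "a < c" "c < b" "a < c'" "c' < b"
    using assms(1-4)[THEN subdivisionsD(5)] by simp_all
  show "c = c'" if "c < c'"
    using noncrossingD[OF noncrossing, of a c' c b] apex_arcs bounds that by simp
  show "c = c'" if "c' < c"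
    using noncrossingD[OF noncrossing, of a c c' b] apex_arcs bounds that by simp
qed

lemma subdivision_apex:
  assumes "S \<in> subdivisions a b" "a + 1 < b"
  obtains c where "a < c" "c < b" "(a, c) \<in> S"
    "S = insert (a, b) (S \<inter> arcs a c \<union> S \<inter> arcs c b)"
proof -
  note subdivision = subdivisionsD[OF assms(1)]
  define ends where "ends = {c. c < b \<and> (a, c) \<in> S}"
  define c where "c = Max ends"
  have "finite ends"
    using subdivision(1) by (intro finite_subset[of ends "{a..b}"]) (auto simp: ends_def)
  moreover have "a + 1 \<in> ends" using subdivision(4) assms(2) by (auto simp: ends_def)
  ultimately have "c \<in> ends" and apex_max: "\<And>y. y \<in> ends \<Longrightarrow> y \<le> c"
    unfolding c_def using Max_in Max_ge by blast+
  then have apex: "a < c" "c < b" "(a, c) \<in> S" using subdivision(1) by (auto simp: ends_def)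
  have "(x, y) = (a, b) \<or> (x, y) \<in> arcs a c \<or> (x, y) \<in> arcs c b" if member: "(x, y) \<in> S" for x y
  proof -
    have bounds: "a \<le> x" "x < y" "y \<le> b" using member subdivision(1) by auto
    then consider "x = a" | "a < x" "x < c" | "c \<le> x" by linarith
    then show ?thesis
    proof cases
      assume "x = a"
      then show ?thesis using apex_max member bounds by (cases "y = b") (auto simp: ends_def)
    next
      assume "a < x" "x < c"
      then show ?thesis using noncrossingD[OF subdivision(2) apex(3) member] bounds by simp
    next
      assume "c \<le> x"
      then show ?thesis using bounds by simp
    qed
  qed
  then have "S \<subseteq> insert (a, b) (S \<inter> arcs a c \<union> S \<inter> arcs c b)" by (intro subrelI) blast
  then have "S = insert (a, b) (S \<inter> arcs a c \<union> S \<inter> arcs c b)" using subdivision(3) by blast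
  then show ?thesis using that apex by blast
qed

text \<open>The apex is the last neighbour of \<open>a\<close> before \<open>b\<close>, so only its chord to \<open>b\<close> may be missing.\<close>

lemma subdivision_cases:
  assumes "S \<in> subdivisions a b" "a + 1 < b"
  obtains (triangle) c S\<^sub>1 S\<^sub>2 where "S\<^sub>1 \<in> subdivisions a c" "S\<^sub>2 \<in> subdivisions c b"
      "S = glue a b S\<^sub>1 S\<^sub>2"
    | (open_triangle) c S\<^sub>1 S\<^sub>2 where "S\<^sub>1 \<in> subdivisions a c" "S\<^sub>2 \<in> subdivisions c b"
      "c + 1 < b" "S = glue a b S\<^sub>1 S\<^sub>2 - {(c, b)}"
proof -
  obtain c where apex: "a < c" "c < b" "(a, c) \<in> S"
    and decomposition: "S = insert (a, b) (S \<inter> arcs a c \<union> S \<inter> arcs c b)"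
    using subdivision_apex[OF assms] .
  note subdivision = subdivisionsD[OF assms(1)]
  define S\<^sub>1 S\<^sub>2 where "S\<^sub>1 = S \<inter> arcs a c" and "S\<^sub>2 = S \<inter> arcs c b \<union> sides c b"
  have "noncrossing S\<^sub>1" "noncrossing (S \<inter> arcs c b)"
    unfolding S\<^sub>1_def using subdivision(2) by (blast intro: noncrossing_subset)+
  moreover have "sides a c \<subseteq> S\<^sub>1" using subdivision(4) apex by (force simp: sides_def S\<^sub>1_def)
  ultimately have parts: "S\<^sub>1 \<in> subdivisions a c" "S\<^sub>2 \<in> subdivisions c b"
    using subdivisions_Un_sides[of "S \<inter> arcs c b" c b] apex
    by (auto simp: subdivisions_def S\<^sub>1_def S\<^sub>2_def)
  have "unit_arcs c b \<subseteq> S \<inter> arcs c b" using subdivision(4) apex by force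
  then have S\<^sub>2_eq: "S\<^sub>2 = insert (c, b) (S \<inter> arcs c b)" by (auto simp: S\<^sub>2_def sides_def)
  show ?thesis
  proof (cases "(c, b) \<in> S")
    case True
    then have "S = glue a b S\<^sub>1 S\<^sub>2"
      using decomposition apex(2) by (simp add: glue_def S\<^sub>1_def S\<^sub>2_eq insert_absorb)
    then show ?thesis using triangle parts by blast
  next
    case False
    then have "c + 1 \<noteq> b" using subsetD[OF subdivision(4), of "(c, c + 1)"] apex by auto
    then have "c + 1 < b" using apex(2) by simp
    moreover have "S = glue a b S\<^sub>1 S\<^sub>2 - {(c, b)}"
      using decomposition False apex(1) unfolding glue_def S\<^sub>1_def S\<^sub>2_eq by blast
    ultimately show ?thesis using open_triangle parts by blast
  qed
qed

lemma subdivisions_unit: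
  assumes "S \<in> subdivisions a (a + 1)"
  shows "S = {(a, a + 1)}"
proof -
  have "arcs a (a + 1) = {(a, a + 1)}" by auto
  then show ?thesis using subdivisionsD(1,3)[OF assms] by blast
qed

lemma card_subdivision_le:
  assumes "S \<in> subdivisions a b"
  shows "int (card S) \<le> 2 * (b - a) - 1"
  using assms
proof (induction "nat (b - a)" arbitrary: a b S rule: less_induct)
  case less
  have card_glue_le: "int (card (glue a b S\<^sub>1 S\<^sub>2)) \<le> 2 * (b - a) - 1"
    if "S\<^sub>1 \<in> subdivisions a c" "S\<^sub>2 \<in> subdivisions c b" for c S\<^sub>1 S\<^sub>2
    using less.hyps[OF _ that(1)] less.hyps[OF _ that(2)] card_glue[OF that]
      subdivisionsD(5)[OF that(1)] subdivisionsD(5)[OF that(2)] by simp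
  show ?case
  proof (cases "a + 1 < b")
    case False
    then have "b = a + 1" using subdivisionsD(5)[OF less.prems] by simp
    then show ?thesis using subdivisions_unit less.prems by fastforce
  next
    case True
    from less.prems True show ?thesis
    proof (cases rule: subdivision_cases)
      case (triangle c S\<^sub>1 S\<^sub>2)
      then show ?thesis using card_glue_le by simp
    next
      case (open_triangle c S\<^sub>1 S\<^sub>2)
      then have "card S \<le> card (glue a b S\<^sub>1 S\<^sub>2)" by (simp add: card_Diff1_le)
      then show ?thesis using card_glue_le[OF open_triangle(1,2)] by simp
    qed
  qed
qed

lemma triangulations_iff_maximal_card:
  assumes "a < b"
  shows "S \<in> triangulations a b \<longleftrightarrow>
    S \<subseteq> arcs a b \<and> noncrossing S \<and> int (card S) = 2 * (b - a) - 1"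
proof
  assume maximal: "S \<subseteq> arcs a b \<and> noncrossing S \<and> int (card S) = 2 * (b - a) - 1"
  then have closure: "S \<union> sides a b \<in> subdivisions a b" using subdivisions_Un_sides assms by blast
  then have "S = S \<union> sides a b"
    using card_subdivision_le[OF closure] subdivisionsD(6)[OF closure] maximal
    by (intro card_seteq) auto
  then show "S \<in> triangulations a b" using closure maximal by (simp add: triangulations_def)
qed (auto simp: triangulations_def subdivisions_def)

lemma triangulation_maximal:
  assumes triangulation: "S \<in> triangulations a b"
    and extension: "t \<in> arcs a b" "noncrossing (insert t S)"
  shows "t \<in> S"
proof (rule ccontr)
  assume "t \<notin> S"
  then have "card (insert t S) = Suc (card S)"
    using subdivisionsD(6)[OF triangulationsD(1)[OF triangulation]] by simp
  moreover have "insert t S \<in> subdivisions a b"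
    using subdivisions_insert[OF triangulationsD(1)[OF triangulation] extension] .
  ultimately show False using card_subdivision_le triangulationsD(2)[OF triangulation] by force
qed

lemma triangulation_cases:
  assumes triangulation: "S \<in> triangulations a b" and "a + 1 < b"
  obtains c S\<^sub>1 S\<^sub>2 where "S\<^sub>1 \<in> triangulations a c" "S\<^sub>2 \<in> triangulations c b"
    "S = glue a b S\<^sub>1 S\<^sub>2"
  using triangulationsD(1)[OF triangulation] assms(2)
proof (cases rule: subdivision_cases)
  case (triangle c S\<^sub>1 S\<^sub>2)
  then show thesis
    using that[of S\<^sub>1 c S\<^sub>2] card_glue[OF triangle(1,2)] triangulationsD(2)[OF triangulation]
      triangle(1,2)[THEN card_subdivision_le] by (simp add: triangulations_def)
next
  case (open_triangle c S\<^sub>1 S\<^sub>2)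
  then show thesis
    using card_open_glue[OF open_triangle(1,2)] triangulationsD(2)[OF triangulation]
      open_triangle(1,2)[THEN card_subdivision_le] by simp
qed

lemma glue_triangulations:
  assumes "S \<in> triangulations a c" "T \<in> triangulations c b"
  shows "glue a b S T \<in> triangulations a b"
  using assms glue_subdivisions[of S a c T b] card_glue[of S a c T b]
  by (simp add: triangulations_def)

lemma triangulations_eq_UN_glue:
  assumes "a + 1 < b"
  shows "triangulations a b =
    (\<Union>c\<in>{a<..<b}. case_prod (glue a b) ` (triangulations a c \<times> triangulations c b))"
proof (intro equalityI subsetI)
  fix S assume "S \<in> triangulations a b"
  then obtain c S\<^sub>1 S\<^sub>2 where parts: "S\<^sub>1 \<in> triangulations a c" "S\<^sub>2 \<in> triangulations c b"
    and "S = glue a b S\<^sub>1 S\<^sub>2" using assms by (rule triangulation_cases)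
  moreover have "c \<in> {a<..<b}"
    using parts[THEN triangulationsD(1), THEN subdivisionsD(5)] by simp
  ultimately show "S \<in> (\<Union>c\<in>{a<..<b}.
      case_prod (glue a b) ` (triangulations a c \<times> triangulations c b))"
    by (intro UN_I image_eqI[of _ _ "(S\<^sub>1, S\<^sub>2)"]) simp_all
qed (auto intro: glue_triangulations)

lemma card_triangulations_rec:
  assumes "a + 1 < b"
  shows "card (triangulations a b) =
    (\<Sum>c\<in>{a<..<b}. card (triangulations a c) * card (triangulations c b))"
proof -
  define glued where
    "glued c = case_prod (glue a b) ` (triangulations a c \<times> triangulations c b)" for c
  have "c = c'" if "S \<in> glued c" "S \<in> glued c'" for S c c'
    using that unfolding glued_def
    by (elim imageE SigmaE) (metis glue_apex_unique triangulationsD(1) case_prod_conv)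
  then have "glued c \<inter> glued c' = {}" if "c \<noteq> c'" for c c' using that by blast
  moreover have "card (glued c) = card (triangulations a c) * card (triangulations c b)" for c
  proof -
    have "inj_on (case_prod (glue a b)) (triangulations a c \<times> triangulations c b)"
      by (intro inj_on_inverseI[of _ "\<lambda>S. (S \<inter> arcs a c, S \<inter> arcs c b)"])
        (clarsimp simp: glue_Int_arcs[OF triangulationsD(1) triangulationsD(1)])
    then show ?thesis by (simp add: glued_def card_image card_cartesian_product)
  qed
  moreover have "triangulations a b = (\<Union>c\<in>{a<..<b}. glued c)"
    unfolding glued_def by (rule triangulations_eq_UN_glue[OF assms])
  moreover have "finite (glued c)" for c by (simp add: glued_def)
  ultimately show ?thesis by (simp add: card_UN_disjoint)
qed

section \<open>Catalan numbers\<close>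

lemma catalan_of_nat: "catalan (real k) = real ((2 * k) choose k) / (real k + 1)"
  by (simp add: catalan_def)

lemma catalan_Suc:
  "catalan (real (Suc k)) = catalan (real k) * (4 * real k + 2) / (real k + 2)"
proof -
  have catalan_fact: "catalan (real j) = fact (2 * j) / (fact j * fact (Suc j))" for j
    by (simp add: catalan_of_nat binomial_fact mult_2)
  show ?thesis unfolding catalan_fact by (simp add: divide_simps) (simp add: algebra_simps)
qed

lemma catalan_eq_gbinomial:
  "catalan (real k) = - (((1 / 2) gchoose Suc k) * (- 4) ^ Suc k) / 2"
proof (induction k)
  case 0
  show ?case using catalan_of_nat[of 0] by simp
next
  case (Suc k)
  have "(real k + 2) * ((1 / 2 :: real) gchoose Suc (Suc k)) =
      (1 / 2 - (real k + 1)) * ((1 / 2) gchoose Suc k)"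
    using gbinomial_absorb_comp[of "1 / 2 :: real" "Suc k"]
      gbinomial_absorption[of "Suc k" "1 / 2 :: real"] by (simp add: algebra_simps)
  then have gbinomial_Suc: "((1 / 2 :: real) gchoose Suc (Suc k)) =
      (1 / 2 - (real k + 1)) * ((1 / 2) gchoose Suc k) / (real k + 2)"
    by (simp add: field_simps)
  show ?case unfolding catalan_Suc Suc gbinomial_Suc by (simp add: field_simps)
qed

text \<open>Up to sign and scaling, the Catalan numbers are the coefficients of \<open>sqrt (1 - 4 x)\<close>, whose
  square is linear.\<close>

lemma catalan_convolution:
  "(\<Sum>k\<le>n. catalan (real k) * catalan (real (n - k))) = catalan (real (Suc n))"
proof -
  define coeff where "coeff k = ((1 / 2 :: real) gchoose k) * (- 4) ^ k" for k
  have catalan: "catalan (real k) = - coeff (Suc k) / 2" for k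
    by (simp add: coeff_def catalan_eq_gbinomial)
  have coeff_0: "coeff 0 = 1" by (simp add: coeff_def)
  define m where "m = Suc (Suc n)"
  have "(\<Sum>k=0..m. coeff k * coeff (m - k)) =
      (\<Sum>k=0..m. ((1 / 2) gchoose k) * ((1 / 2) gchoose (m - k))) * (- 4) ^ m"
    by (auto simp: sum_distrib_right coeff_def power_add[symmetric] intro!: sum.cong)
  also have "(\<Sum>k=0..m. ((1 / 2 :: real) gchoose k) * ((1 / 2) gchoose (m - k))) =
      of_nat 1 gchoose m"
    by (subst gbinomial_Vandermonde) simp
  also have "\<dots> = 0" unfolding m_def binomial_gbinomial[symmetric] by simp
  finally have "(\<Sum>k\<le>Suc (Suc n). coeff k * coeff (Suc (Suc n) - k)) = 0"
    by (simp add: m_def atMost_atLeast0)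
  moreover have "(\<Sum>k\<le>Suc (Suc n). coeff k * coeff (Suc (Suc n) - k)) =
      2 * coeff (Suc (Suc n)) + (\<Sum>k\<le>n. coeff (Suc k) * coeff (Suc (n - k)))"
    unfolding sum.atMost_Suc[of _ "Suc n"] sum.atMost_Suc_shift[of _ n]
    by (simp add: coeff_0 Suc_diff_le)
  ultimately show ?thesis unfolding catalan by (simp flip: sum_divide_distrib)
qed

lemma triangulations_unit: "triangulations a (a + 1) = {{(a, a + 1)}}"
proof -
  have "{(a, a + 1)} \<in> triangulations a (a + 1)"
    by (auto simp: triangulations_iff_maximal_card noncrossing_def)
  then show ?thesis using subdivisions_unit triangulationsD(1) by blast
qed

lemma card_triangulations:
  "real (card (triangulations a (a + 1 + int n))) = catalan (real n)"
proof (induction n arbitrary: a rule: less_induct)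
  case (less n)
  show ?case
  proof (cases n)
    case 0
    then show ?thesis using catalan_of_nat[of 0] by (simp add: triangulations_unit)
  next
    case (Suc l)
    let ?T = "\<lambda>a b. real (card (triangulations a b))"
    have "{a<..<a + 1 + int n} = (\<lambda>k. a + 1 + int k) ` {..l}"
    proof (intro equalityI subsetI)
      fix c assume "c \<in> {a<..<a + 1 + int n}"
      then show "c \<in> (\<lambda>k. a + 1 + int k) ` {..l}"
        by (intro image_eqI[of _ _ "nat (c - a - 1)"]) (auto simp: Suc)
    qed (auto simp: Suc)
    then have "?T a (a + 1 + int n) =
        (\<Sum>k\<le>l. ?T a (a + 1 + int k) * ?T (a + 1 + int k) (a + 1 + int n))"
      by (simp add: card_triangulations_rec Suc sum.reindex inj_on_def)
    also have "\<dots> = (\<Sum>k\<le>l. catalan (real k) * catalan (real (l - k)))"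
    proof (rule sum.cong)
      fix k assume "k \<in> {..l}"
      then have "k < n" "l - k < n" "a + 1 + int n = (a + 1 + int k) + 1 + int (l - k)"
        by (simp_all add: Suc)
      then show "?T a (a + 1 + int k) * ?T (a + 1 + int k) (a + 1 + int n) =
          catalan (real k) * catalan (real (l - k))"
        using less.IH[of k a] less.IH[of "l - k" "a + 1 + int k"] by (simp only:)
    qed simp
    also have "\<dots> = catalan (real n)" using catalan_convolution Suc by simp
    finally show ?thesis .
  qed
qed

section \<open>The two ways to complete an almost-triangulation\<close>

definition addable :: "int \<Rightarrow> int \<Rightarrow> (int \<times> int) set \<Rightarrow> (int \<times> int) set" where
  "addable a b S = {t \<in> arcs a b - S. noncrossing (insert t S)}"

lemma addable_iff:
  assumes "noncrossing S"
  shows "t \<in> addable a b S \<longleftrightarrow>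
    t \<in> arcs a b \<and> t \<notin> S \<and> (\<forall>s\<in>S. \<not> crossing s t \<and> \<not> crossing t s)"
  using assms by (auto simp: addable_def noncrossing_insert)

lemma addable_triangulation: "S \<in> triangulations a b \<Longrightarrow> addable a b S = {}"
  using triangulation_maximal by (auto simp: addable_def)

lemma addable_mono_interval:
  assumes "t \<in> addable a b S" "S' \<subseteq> S" "t \<in> arcs a' b'"
  shows "t \<in> addable a' b' S'"
  using assms by (auto simp: addable_def intro: noncrossing_subset)

lemma addable_glue:
  assumes "S \<in> subdivisions a c" "T \<in> subdivisions c b"
  shows "addable a b (glue a b S T) = addable a c S \<union> addable c b T"
proof (intro equalityI subrelI)
  note left = subdivisionsD[OF assms(1)] and right = subdivisionsD[OF assms(2)]
    and glued = subdivisionsD(2)[OF glue_subdivisions[OF assms]]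
  fix u v
  {
    assume addable: "(u, v) \<in> addable a b (glue a b S T)"
    then have arc: "a \<le> u" "u < v" "v \<le> b" "(u, v) \<noteq> (a, b)"
      by (auto simp: addable_def glue_def)
    have uncrossed: "\<not> crossing s (u, v)" "\<not> crossing (u, v) s" if "s \<in> glue a b S T" for s
      using addable that unfolding addable_iff[OF glued] by blast+
    have "(a, c) \<in> glue a b S T" "(c, b) \<in> glue a b S T"
      using left(3) right(3) by (simp_all add: glue_def)
    from uncrossed(1)[OF this(1)] uncrossed(2)[OF this(2)]
    have "\<not> crossing (a, c) (u, v)" "\<not> crossing (u, v) (c, b)" .
    then have "v \<le> c \<or> c \<le> u" using arc by auto
    then show "(u, v) \<in> addable a c S \<union> addable c b T"
      using addable_mono_interval[OF addable] arc by (auto simp: glue_def)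
  next
    assume "(u, v) \<in> addable a c S \<union> addable c b T"
    then show "(u, v) \<in> addable a b (glue a b S T)"
      unfolding Un_iff addable_iff[OF glued] addable_iff[OF left(2)] addable_iff[OF right(2)]
      using subsetD[OF left(1)] subsetD[OF right(1)] left(5) right(5) by (fastforce simp: glue_def)
  }
qed

lemma uncrossed_arc_quadrilateral:
  assumes "a \<le> u" "u < v" "v \<le> b" "(u, v) \<noteq> (a, b)" and "a < c" "c < e" "e < b"
    and "\<not> (a \<le> u \<and> v \<le> c)" "\<not> (c \<le> u \<and> v \<le> e)" "\<not> (e \<le> u \<and> v \<le> b)"
    and "\<And>s. s \<in> {(a, c), (c, e), (e, b)} \<Longrightarrow> \<not> crossing s (u, v) \<and> \<not> crossing (u, v) s"
  shows "(u, v) = (a, e) \<or> (u, v) = (c, b)"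
proof -
  note not_crossing = assms(11)[of "(a, c)"] assms(11)[of "(c, e)"] assms(11)[of "(e, b)"]
  show ?thesis
  proof (cases "u < c")
    case True
    then have "u = a" "v = e" using assms(1-10) not_crossing by auto
    then show ?thesis by simp
  next
    case False
    then have "u = c" "v = b" using assms(1-10) not_crossing by auto
    then show ?thesis by simp
  qed
qed

lemma not_crossing_quadrilateral_diagonal:
  assumes "a < c" "c < e" "e < b" and "t = (a, e) \<or> t = (c, b)"
    and "s \<in> insert (a, b) (arcs a c \<union> arcs c e \<union> arcs e b)"
  shows "\<not> crossing s t" "\<not> crossing t s" "s \<noteq> t"
proof -
  consider "s = (a, b)" | "s \<in> arcs a c" | "s \<in> arcs c e" | "s \<in> arcs e b" using assms(5) by blast
  then have "\<not> crossing s t \<and> \<not> crossing t s \<and> s \<noteq> t" using assms(1-4) by cases (cases s; auto)+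
  then show "\<not> crossing s t" "\<not> crossing t s" "s \<noteq> t" by simp_all
qed

lemma addable_quadrilateral:
  assumes "S \<in> triangulations a c" "T \<in> triangulations c e" "U \<in> triangulations e b"
  shows "addable a b (insert (a, b) (S \<union> T \<union> U)) = {(a, e), (c, b)}"
proof (intro equalityI subsetI)
  let ?Q = "insert (a, b) (S \<union> T \<union> U)"
  note left = subdivisionsD[OF triangulationsD(1)[OF assms(1)]]
    and middle = subdivisionsD[OF triangulationsD(1)[OF assms(2)]]
    and right = subdivisionsD[OF triangulationsD(1)[OF assms(3)]]
  have "?Q \<subseteq> glue a b S (glue c b T U)" by (auto simp: glue_def)
  moreover have "noncrossing (glue a b S (glue c b T U))"
    using subdivisionsD(2)[OF triangulationsD(1)] glue_triangulations assms by blast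
  ultimately have noncrossing: "noncrossing ?Q" by (rule noncrossing_subset[rotated])
  {
    fix t assume t_mem: "t \<in> addable a b ?Q"
    obtain u v where t_eq: "t = (u, v)" by (cases t)
    have arc: "a \<le> u" "u < v" "v \<le> b" "(u, v) \<noteq> (a, b)"
      using t_mem by (auto simp: addable_def t_eq)
    have "\<not> (a \<le> u \<and> v \<le> c)" "\<not> (c \<le> u \<and> v \<le> e)" "\<not> (e \<le> u \<and> v \<le> b)"
      using addable_mono_interval[OF t_mem, of S a c] addable_mono_interval[OF t_mem, of T c e]
        addable_mono_interval[OF t_mem, of U e b] assms[THEN addable_triangulation] arc(2)
      by (auto simp: t_eq)
    moreover have "\<not> crossing s (u, v) \<and> \<not> crossing (u, v) s"
      if "s \<in> {(a, c), (c, e), (e, b)}" for s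
    proof -
      have "s \<in> ?Q" using that left(3) middle(3) right(3) by blast
      then show ?thesis using t_mem unfolding addable_iff[OF noncrossing] t_eq by blast
    qed
    ultimately show "t \<in> {(a, e), (c, b)}"
      using uncrossed_arc_quadrilateral[OF arc left(5) middle(5) right(5)] by (simp add: t_eq)
  next
    fix t assume t_mem: "t \<in> {(a, e), (c, b)}"
    have "?Q \<subseteq> insert (a, b) (arcs a c \<union> arcs c e \<union> arcs e b)"
      using left(1) middle(1) right(1) by blast
    then have "\<not> crossing s t \<and> \<not> crossing t s \<and> s \<noteq> t" if "s \<in> ?Q" for s
      using not_crossing_quadrilateral_diagonal[OF left(5) middle(5) right(5), of t s] t_mem that
      by blast
    moreover have "t \<in> arcs a b" using t_mem left(5) middle(5) right(5) by auto
    ultimately show "t \<in> addable a b ?Q" unfolding addable_iff[OF noncrossing] by blast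
  }
qed

lemma addable_open_glue:
  assumes "S \<in> triangulations a c" "T \<in> triangulations c b" "c + 1 < b"
  obtains e where "c < e" "e < b" "addable a b (glue a b S T - {(c, b)}) = {(a, e), (c, b)}"
proof -
  obtain e U V where halves: "U \<in> triangulations c e" "V \<in> triangulations e b" "T = glue c b U V"
    using assms(2,3) by (rule triangulation_cases)
  note parts = assms(1) halves(1,2)
  note bounds = parts[THEN triangulationsD(1), THEN subdivisionsD(5)]
  have "(c, b) \<notin> S \<union> U \<union> V"
    using parts[THEN triangulationsD(1), THEN subdivisionsD(1)] bounds by auto
  then have "glue a b S T - {(c, b)} = insert (a, b) (S \<union> U \<union> V)"
    using bounds unfolding halves(3) glue_def by auto
  then show thesis using that bounds addable_quadrilateral[OF parts] by simp
qed

lemma addable_almost_triangulation: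
  assumes "S \<in> subdivisions a b" "int (card S) = 2 * (b - a) - 2"
  shows "\<exists>p q r s. p < q \<and> q < r \<and> r < s \<and> addable a b S = {(p, r), (q, s)}"
  using assms
proof (induction "nat (b - a)" arbitrary: a b S rule: less_induct)
  case less
  have "a + 1 < b"
    using less.prems(2) subdivisionsD(3,5,6)[OF less.prems(1)] by (cases "b = a + 1") auto
  with less.prems(1) show ?case
  proof (cases rule: subdivision_cases)
    case (triangle c S\<^sub>1 S\<^sub>2)
    note parts = triangle(1,2)
    have addable: "addable a b S = addable a c S\<^sub>1 \<union> addable c b S\<^sub>2"
      unfolding triangle(3) by (rule addable_glue[OF parts])
    consider (left) "int (card S\<^sub>1) = 2 * (c - a) - 2" "S\<^sub>2 \<in> triangulations c b"
      | (right) "S\<^sub>1 \<in> triangulations a c" "int (card S\<^sub>2) = 2 * (b - c) - 2"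
      using parts[THEN card_subdivision_le] card_glue[OF parts] less.prems(2) parts
      unfolding triangle(3) triangulations_def by fastforce
    then show ?thesis
    proof cases
      case left
      then show ?thesis using less.hyps[OF _ parts(1) left(1)] parts[THEN subdivisionsD(5)]
        by (simp add: addable addable_triangulation)
    next
      case right
      then show ?thesis using less.hyps[OF _ parts(2) right(2)] parts[THEN subdivisionsD(5)]
        by (simp add: addable addable_triangulation)
    qed
  next
    case (open_triangle c S\<^sub>1 S\<^sub>2)
    note parts = open_triangle(1,2)
    have triangulated: "S\<^sub>1 \<in> triangulations a c" "S\<^sub>2 \<in> triangulations c b"
      using parts[THEN card_subdivision_le] card_open_glue[OF parts] less.prems(2) parts
      unfolding open_triangle(4) by (simp_all add: triangulations_def)
    obtain e where "c < e" "e < b" "addable a b S = {(a, e), (c, b)}"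
      unfolding open_triangle(4) using addable_open_glue[OF triangulated open_triangle(3)] .
    then show ?thesis using subdivisionsD(5)[OF parts(1)] by blast
  qed
qed

section \<open>Dissections as noncrossing families of arcs\<close>

definition inner_arcs :: "int \<Rightarrow> int \<Rightarrow> (int \<times> int) set" where
  "inner_arcs a b = arcs a b - sides a b"

definition noncrossing_subsets :: "(int \<times> int) set \<Rightarrow> nat \<Rightarrow> (int \<times> int) set set" where
  "noncrossing_subsets A k = {S. S \<subseteq> A \<and> noncrossing S \<and> card S = k}"

definition chord :: "int \<times> int \<Rightarrow> int set" where
  "chord t = {fst t, snd t}"

lemma inner_arcs_iff [simp]:
  "(x, y) \<in> inner_arcs a b \<longleftrightarrow> a \<le> x \<and> x + 1 < y \<and> y \<le> b \<and> (x, y) \<noteq> (a, b)"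
  by (auto simp: inner_arcs_def sides_def)

lemma inner_arcs_subset: "inner_arcs a b \<subseteq> arcs a b"
  by (simp add: inner_arcs_def)

lemma chord_pair [simp]: "chord (x, y) = {x, y}"
  by (simp add: chord_def)

lemma inj_on_chord: "inj_on chord (arcs a b)"
  by (auto simp: inj_on_def doubleton_eq_iff)

lemma card_chord_image: "S \<subseteq> arcs a b \<Longrightarrow> card (chord ` S) = card S"
  using inj_on_chord by (intro card_image) (rule inj_on_subset)

lemma crosses_chord:
  assumes "s \<in> arcs a b" "t \<in> arcs a b"
  shows "crosses (chord s) (chord t) \<longleftrightarrow> crossing s t \<or> crossing t s"
proof -
  obtain x y u v where pairs: "s = (x, y)" "t = (u, v)" by (cases s; cases t) auto
  then have "x < y" "u < v" using assms by auto
  then show ?thesis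
    by (auto simp: pairs crosses_def doubleton_eq_iff)
qed

lemma not_crosses_self: "\<not> crosses d d"
  by (auto simp: crosses_def doubleton_eq_iff)

lemma noncrossing_iff_not_crosses:
  assumes "S \<subseteq> arcs a b"
  shows "noncrossing S \<longleftrightarrow> (\<forall>d\<in>chord ` S. \<forall>e\<in>chord ` S. \<not> crosses d e)"
proof -
  have "crosses (chord s) (chord t) \<longleftrightarrow> crossing s t \<or> crossing t s" if "s \<in> S" "t \<in> S" for s t
    using crosses_chord that assms by blast
  then show ?thesis unfolding noncrossing_def by blast
qed

lemma pair_in_diagonals_iff:
  assumes "0 \<le> x" "x < y" "y < int n"
  shows "{x, y} \<in> diagonals n \<longleftrightarrow> (x, y) \<in> inner_arcs 0 (int n - 1)"
proof -
  have "{x, y} \<in> diagonals n \<longleftrightarrow> y \<noteq> (x + 1) mod int n \<and> x \<noteq> (y + 1) mod int n"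
    using assms by (fastforce simp: diagonals_def doubleton_eq_iff)
  moreover have "(x + 1) mod int n = x + 1" using assms by simp
  moreover have "(y + 1) mod int n = (if y = int n - 1 then 0 else y + 1)" using assms by auto
  ultimately show ?thesis using assms by auto
qed

lemma diagonals_eq_chords: "diagonals n = chord ` inner_arcs 0 (int n - 1)"
proof (intro equalityI subsetI)
  fix d assume diagonal: "d \<in> diagonals n"
  then obtain a b where "d = {a, b}" "a \<in> {0..<int n}" "b \<in> {0..<int n}" "a \<noteq> b"
    unfolding diagonals_def by blast
  then have "d = chord (min a b, max a b)" "0 \<le> min a b" "min a b < max a b" "max a b < int n"
    by (auto simp: min_def max_def)
  then show "d \<in> chord ` inner_arcs 0 (int n - 1)"
    using pair_in_diagonals_iff diagonal by (metis chord_pair imageI)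
next
  fix d assume "d \<in> chord ` inner_arcs 0 (int n - 1)"
  then obtain x y where "d = {x, y}" "(x, y) \<in> inner_arcs 0 (int n - 1)" by auto
  then show "d \<in> diagonals n" using pair_in_diagonals_iff[of x y n] by simp
qed

lemma diagonal_cases:
  assumes "e \<in> diagonals n"
  obtains x y where "e = {x, y}" "0 \<le> x" "x + 1 < y" "y < int n" "(x, y) \<noteq> (0, int n - 1)"
  using assms unfolding diagonals_eq_chords by auto

lemma finite_diagonals [simp]: "finite (diagonals n)"
  using finite_subset_arcs[OF inner_arcs_subset] by (simp add: diagonals_eq_chords)

lemma dissectionsD:
  assumes "D \<in> dissections n k"
  shows "D \<subseteq> diagonals n" "card D = k" "\<And>d e. d \<in> D \<Longrightarrow> e \<in> D \<Longrightarrow> \<not> crosses d e" "finite D"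
  using assms finite_subset[OF _ finite_diagonals] by (auto simp: dissections_def)

lemma finite_dissections [simp]: "finite (dissections n k)"
  by (rule finite_subset[of _ "Pow (diagonals n)"]) (auto dest: dissectionsD)

lemma dissections_eq_chords:
  "dissections n k = image chord ` noncrossing_subsets (inner_arcs 0 (int n - 1)) k"
proof -
  let ?I = "inner_arcs 0 (int n - 1)"
  have chord_dissection: "chord ` S \<in> dissections n k \<longleftrightarrow> S \<in> noncrossing_subsets ?I k"
    if family: "S \<subseteq> ?I" for S
  proof -
    have "S \<subseteq> arcs 0 (int n - 1)" using family inner_arcs_subset by blast
    note card_chord_image[OF this] noncrossing_iff_not_crosses[OF this]
    moreover have "chord ` S \<subseteq> diagonals n" unfolding diagonals_eq_chords
      using family by (rule image_mono)
    ultimately show ?thesis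
      using family by (simp add: dissections_def noncrossing_subsets_def conj_commute)
  qed
  show ?thesis
  proof (intro equalityI subsetI)
    fix D assume dissection: "D \<in> dissections n k"
    obtain S where family: "S \<subseteq> ?I" "D = chord ` S"
      using dissectionsD(1)[OF dissection] unfolding diagonals_eq_chords subset_image_iff by blast
    then have "S \<in> noncrossing_subsets ?I k" using chord_dissection[OF family(1)] dissection by simp
    then show "D \<in> image chord ` noncrossing_subsets ?I k" using family(2) by simp
  next
    fix D assume "D \<in> image chord ` noncrossing_subsets ?I k"
    then obtain S where family: "S \<in> noncrossing_subsets ?I k" "D = chord ` S" by (rule imageE)
    then have "S \<subseteq> ?I" by (simp add: noncrossing_subsets_def)
    then show "D \<in> dissections n k" using chord_dissection[of S] family by simp
  qed
qed

lemma card_noncrossing_subsets_maximal: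
  assumes "a < b" "B \<subseteq> sides a b" "int k + int (card B) = 2 * (b - a) - 1"
  shows "card (noncrossing_subsets (arcs a b - B) k) = card (triangulations a b)"
proof -
  have B_arcs: "B \<subseteq> arcs a b" "finite B"
    using assms(1,2) sides_subset_arcs finite_subset_arcs by blast+
  have noncrossing_Un: "noncrossing (S \<union> B)" if "S \<subseteq> arcs a b" "noncrossing S" for S
    using noncrossing_Un_sides[OF that(1)] that(2) assms(2) noncrossing_subset[of "S \<union> sides a b"]
    by blast
  have "bij_betw (\<lambda>S. S \<union> B) (noncrossing_subsets (arcs a b - B) k) (triangulations a b)"
  proof (rule bij_betw_byWitness[where f' = "\<lambda>S. S - B"])
    show "(\<lambda>S. S \<union> B) ` noncrossing_subsets (arcs a b - B) k \<subseteq> triangulations a b"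
    proof clarify
      fix S assume "S \<in> noncrossing_subsets (arcs a b - B) k"
      then have family: "S \<subseteq> arcs a b" "S \<inter> B = {}" "noncrossing S" "card S = k"
        by (auto simp: noncrossing_subsets_def)
      then have "card (S \<union> B) = k + card B"
        using B_arcs finite_subset_arcs by (simp add: card_Un_disjoint)
      then show "S \<union> B \<in> triangulations a b"
        using triangulations_iff_maximal_card[OF assms(1)] noncrossing_Un family
          B_arcs(1) assms(3) by simp
    qed
    show "(\<lambda>S. S - B) ` triangulations a b \<subseteq> noncrossing_subsets (arcs a b - B) k"
    proof clarify
      fix S assume family: "S \<in> triangulations a b"
      note subdivision = triangulationsD(1)[OF family]
      have "B \<subseteq> S" using subdivision assms(2) by (auto simp: subdivisions_def)
      then have "card (S - B) = k"
        using triangulationsD(2)[OF family] assms(3) B_arcs(2) card_Diff_subset[of B S] by simp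
      then show "S - B \<in> noncrossing_subsets (arcs a b - B) k"
        using subdivisionsD(1,2)[OF subdivision] noncrossing_subset
        by (auto simp: noncrossing_subsets_def)
    qed
    show "\<forall>S\<in>triangulations a b. S - B \<union> B = S"
      using triangulationsD(1) assms(2) by (fastforce simp: subdivisions_def)
  qed (auto simp: noncrossing_subsets_def)
  then show ?thesis by (rule bij_betw_same_card)
qed

lemma card_noncrossing_inner_arcs:
  assumes "a + 1 < b"
  shows "card (noncrossing_subsets (inner_arcs a b) (nat (b - a - 2))) = card (triangulations a b)"
  unfolding inner_arcs_def
  using assms card_sides[OF assms] by (intro card_noncrossing_subsets_maximal) auto

lemma card_dissections_triangulation:
  assumes "n \<ge> 3"
  shows "real (card (dissections n (n - 3))) = catalan (real n - 2)"
proof -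
  have "noncrossing_subsets (inner_arcs 0 (int n - 1)) (n - 3) \<subseteq> Pow (arcs 0 (int n - 1))"
    using inner_arcs_subset by (auto simp: noncrossing_subsets_def)
  then have "card (dissections n (n - 3)) =
      card (noncrossing_subsets (inner_arcs 0 (int n - 1)) (n - 3))"
    unfolding dissections_eq_chords
    using inj_on_image_Pow[OF inj_on_chord] by (intro card_image) (rule inj_on_subset)
  also have "\<dots> = card (triangulations 0 (int n - 1))"
    using card_noncrossing_inner_arcs[of 0 "int n - 1"] assms by (simp add: nat_diff_distrib)
  also have "int n - 1 = 0 + 1 + int (n - 2)" using assms by simp
  finally show ?thesis using assms by (simp only: card_triangulations) (simp add: of_nat_diff)
qed

definition completions :: "nat \<Rightarrow> int set set \<Rightarrow> int set set" where
  "completions n D = {e \<in> diagonals n - D. \<forall>d\<in>D. \<not> crosses d e}"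

lemma addable_Un_sides:
  assumes "S \<subseteq> arcs a b"
  shows "addable a b (S \<union> sides a b) = {t \<in> inner_arcs a b - S. noncrossing (insert t S)}"
proof -
  have "noncrossing (insert t (S \<union> sides a b)) \<longleftrightarrow> noncrossing (insert t S)" if "t \<in> arcs a b" for t
    using noncrossing_Un_sides[of "insert t S" a b] that assms by simp
  then show ?thesis by (auto simp: addable_def inner_arcs_def)
qed

lemma completions_eq_addable:
  assumes "S \<in> noncrossing_subsets (inner_arcs 0 (int n - 1)) k"
  shows "completions n (chord ` S) =
    chord ` addable 0 (int n - 1) (S \<union> sides 0 (int n - 1))"
proof -
  let ?I = "inner_arcs 0 (int n - 1)"
  have family: "S \<subseteq> ?I" "S \<subseteq> arcs 0 (int n - 1)" "noncrossing S"
    using assms inner_arcs_subset by (auto simp: noncrossing_subsets_def)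
  have "noncrossing (insert t S) \<longleftrightarrow> (\<forall>s\<in>S. \<not> crosses (chord s) (chord t))" if "t \<in> ?I" for t
    using that family crosses_chord inner_arcs_subset unfolding noncrossing_insert by blast
  moreover have "diagonals n - chord ` S = chord ` (?I - S)"
    unfolding diagonals_eq_chords
    using inj_on_image_set_diff[OF inj_on_chord _ family(2), of ?I] inner_arcs_subset by blast
  ultimately show ?thesis unfolding completions_def addable_Un_sides[OF family(2)] by auto
qed

lemma completions_almost_triangulation:
  assumes "n \<ge> 4" "D \<in> dissections n (n - 4)"
  obtains p q r s where "0 \<le> p" "p < q" "q < r" "r < s" "s < int n"
    "completions n D = {{p, r}, {q, s}}"
proof -
  define b where "b = int n - 1"
  obtain S where family: "S \<in> noncrossing_subsets (inner_arcs 0 b) (n - 4)" and D_eq: "D =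
      chord ` S"
    using assms(2) unfolding dissections_eq_chords b_def by blast
  then have "S \<subseteq> inner_arcs 0 b" "noncrossing S" "card S = n - 4"
    by (auto simp: noncrossing_subsets_def)
  moreover from this have "S \<subseteq> arcs 0 b" "S \<inter> sides 0 b = {}" by (auto simp: inner_arcs_def)
  ultimately have "S \<union> sides 0 b \<in> subdivisions 0 b"
    and "int (card (S \<union> sides 0 b)) = 2 * (b - 0) - 2"
    using subdivisions_Un_sides[of S 0 b] card_sides[of 0 b] assms(1)
      finite_subset_arcs[of _ 0 b] sides_subset_arcs[of 0 b]
    by (simp_all add: b_def card_Un_disjoint)
  from addable_almost_triangulation[OF this] obtain p q r s where
    pqrs: "p < q" "q < r" "r < s" and addable: "addable 0 b (S \<union> sides 0 b) = {(p, r), (q, s)}"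
    by blast
  have "(p, r) \<in> arcs 0 b" "(q, s) \<in> arcs 0 b"
    using addable unfolding addable_def by blast+
  then have "0 \<le> p" "s < int n" by (auto simp: b_def)
  moreover have "completions n D = {{p, r}, {q, s}}"
    using completions_eq_addable[of S n] family addable by (simp add: b_def D_eq)
  ultimately show thesis using that pqrs by blast
qed

lemma card_completions_almost_triangulation:
  assumes "n \<ge> 4" "D \<in> dissections n (n - 4)"
  shows "card (completions n D) = 2"
proof -
  obtain p q r s where "p < q" "q < r" "r < s" "completions n D = {{p, r}, {q, s}}"
    using completions_almost_triangulation[OF assms] by metis
  moreover from this have "{p, r} \<noteq> {q, s}" by (auto simp: doubleton_eq_iff)
  ultimately show ?thesis by simp
qed

lemma sum_card_completions:
  "(\<Sum>D\<in>dissections n k. card (completions n D)) = Suc k * card (dissections n (Suc k))"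
proof -
  let ?added = "SIGMA D:dissections n k. completions n D"
    and ?removed = "SIGMA T:dissections n (Suc k). T"
  have "bij_betw (\<lambda>(D, e). (insert e D, e)) ?added ?removed"
  proof (rule bij_betw_byWitness[where f' = "\<lambda>(T, e). (T - {e}, e)"])
    show "(\<lambda>(D, e). (insert e D, e)) ` ?added \<subseteq> ?removed"
    proof clarify
      fix D e assume dissection: "D \<in> dissections n k" and e_mem: "e \<in> completions n D"
      have "card (insert e D) = Suc k"
        using dissectionsD(2,4)[OF dissection] e_mem by (simp add: completions_def)
      then show "insert e D \<in> dissections n (Suc k) \<and> e \<in> insert e D"
        using dissection e_mem crosses_sym not_crosses_self
        by (auto simp: dissections_def completions_def)
    qed
    show "(\<lambda>(T, e). (T - {e}, e)) ` ?removed \<subseteq> ?added"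
    proof clarify
      fix T e assume dissection: "T \<in> dissections n (Suc k)" and e_mem: "e \<in> T"
      have "card (T - {e}) = k" using dissectionsD(2)[OF dissection] e_mem by simp
      then show "T - {e} \<in> dissections n k \<and> e \<in> completions n (T - {e})"
        using dissection e_mem by (auto simp: dissections_def completions_def)
    qed
  qed (auto simp: completions_def)
  then have "card ?added = card ?removed" by (rule bij_betw_same_card)
  moreover have "card ?added = (\<Sum>D\<in>dissections n k. card (completions n D))"
    by (intro card_SigmaI) (simp_all add: completions_def)
  moreover have "card ?removed = (\<Sum>T\<in>dissections n (Suc k). card T)"
    by (intro card_SigmaI) (simp_all add: dissectionsD(4))
  ultimately show ?thesis by (simp add: dissectionsD(2))
qed

lemma card_almost_triangulations:
  assumes "n \<ge> 4"
  shows "2 * real (card (dissections n (n - 4))) = (real n - 3) * catalan (real n - 2)"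
proof -
  have "Suc (n - 4) = n - 3" using assms by simp
  then have "2 * card (dissections n (n - 4)) = (n - 3) * card (dissections n (n - 3))"
    using sum_card_completions[of n "n - 4"] card_completions_almost_triangulation[OF assms] by simp
  then have "2 * real (card (dissections n (n - 4))) =
      real (n - 3) * real (card (dissections n (n - 3)))"
    by (metis of_nat_mult of_nat_numeral)
  then show ?thesis using card_dissections_triangulation assms by (simp add: of_nat_diff)
qed

section \<open>Rotations\<close>

abbreviation turn :: "nat \<Rightarrow> int \<Rightarrow> int set \<Rightarrow> int set" where
  "turn n g \<equiv> image (rotate_vertex n g)"

lemma rotate_vertex_cong: "g mod int n = h mod int n \<Longrightarrow> rotate_vertex n g = rotate_vertex n h"
  unfolding rotate_vertex_def by (metis mod_add_right_eq)

lemma turn_turn: "turn n g (turn n h d) = turn n (g + h) d"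
proof -
  have "rotate_vertex n ((g + h) mod int n) = rotate_vertex n (g + h)"
    by (rule rotate_vertex_cong) simp
  then show ?thesis by (simp add: image_image rotate_vertex_add)
qed

lemma turn_image_turn_image: "turn n g ` turn n h ` D = turn n (g + h) ` D"
  by (subst image_image) (simp only: turn_turn)

lemma turn_0: "d \<subseteq> {0..<int n} \<Longrightarrow> turn n 0 d = d"
  by (force simp: subset_iff rotate_vertex_0)

lemma turn_uminus_turn: "d \<subseteq> {0..<int n} \<Longrightarrow> turn n (- g) (turn n g d) = d"
  by (simp add: turn_turn turn_0)

lemma turn_uminus_image: "D \<subseteq> diagonals n \<Longrightarrow> turn n (- g) ` turn n g ` D = D"
  using rotate_set_0[of D n] by (simp only: turn_image_turn_image) simp

lemma inj_on_turn: "inj_on (turn n g) (Pow {0..<int n})"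
  by (intro inj_on_inverseI[of _ "turn n (- g)"]) (simp add: turn_uminus_turn)

lemma turn_subset: "n > 0 \<Longrightarrow> turn n g d \<subseteq> {0..<int n}"
  using rotate_vertex_in by blast

lemma diagonals_subset_Pow: "diagonals n \<subseteq> Pow {0..<int n}"
  using diagonals_subset by auto

lemma crosses_turn:
  assumes n_pos: "n > 0" and d_vertices: "d \<subseteq> {0..<int n}" and e_vertices: "e \<subseteq> {0..<int n}"
  shows "crosses (turn n g d) (turn n g e) \<longleftrightarrow> crosses d e"
proof -
  have crosses_imp: "crosses (turn n h x) (turn n h y)"
    if "crosses x y" "x \<subseteq> {0..<int n}" "y \<subseteq> {0..<int n}" for h x y
    using crosses_rotate[OF that(2,3) _ that(1), of "h mod int n"] n_pos
      rotate_vertex_cong[of "h mod int n" n h] by simp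
  show ?thesis
    using crosses_imp[of d e g] crosses_imp[of "turn n g d" "turn n g e" "- g"]
      d_vertices e_vertices turn_subset[OF n_pos, of g] turn_uminus_turn by metis
qed

lemma turn_dissection:
  assumes "n > 0" "D \<in> dissections n k"
  shows "turn n g ` D \<in> dissections n k"
  using rotate_dissection[OF assms(1) _ assms(2), of "g mod int n"] assms(1)
    rotate_vertex_cong[of "g mod int n" n g] by simp

lemma turn_completion:
  assumes n_pos: "n > 0" and D_diagonals: "D \<subseteq> diagonals n" and completion: "e \<in> completions n D"
  shows "turn n g e \<in> completions n (turn n g ` D)"
proof -
  have compatible: "e \<in> diagonals n" "e \<notin> D" "\<And>d. d \<in> D \<Longrightarrow> \<not> crosses d e"
    using completion by (auto simp: completions_def)
  have "turn n g e \<notin> turn n g ` D"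
    using inj_on_image_mem_iff[OF inj_on_turn, of e n D g] D_diagonals compatible(1,2)
      diagonals_subset_Pow by blast
  moreover have "\<not> crosses (turn n g d) (turn n g e)" if "d \<in> D" for d
    using crosses_turn[OF n_pos diagonals_subset diagonals_subset, of d e]
      D_diagonals compatible that by blast
  ultimately show ?thesis
    using rotate_diagonal[OF n_pos compatible(1)] by (auto simp: completions_def)
qed

lemma completions_turn:
  assumes n_pos: "n > 0" and D_diagonals: "D \<subseteq> diagonals n"
  shows "completions n (turn n g ` D) = turn n g ` completions n D"
proof (intro equalityI subsetI)
  fix e assume completion: "e \<in> completions n (turn n g ` D)"
  have "turn n g ` D \<subseteq> diagonals n" using rotate_diagonal[OF n_pos] D_diagonals by blast
  from turn_completion[OF n_pos this completion, of "- g"] have "turn n (- g) e \<in> completions n D"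
    unfolding turn_uminus_image[OF D_diagonals] .
  moreover have "turn n g (turn n (- g) e) = e"
    using turn_uminus_turn[of e n "- g"] completion diagonals_subset by (auto simp: completions_def)
  ultimately show "e \<in> turn n g ` completions n D" by (metis imageI)
qed (use turn_completion[OF n_pos D_diagonals] in blast)

section \<open>Dissections assembled from equal sectors\<close>

locale sectors =
  fixes n d :: nat and m :: int
  assumes n_eq: "int n = int d * m" and m_pos: "m \<ge> 1" and d_ge: "d \<ge> 2"
begin

lemma double_m_le: "2 * m \<le> int n"
  using n_eq m_pos d_ge by simp

lemma n_pos: "n > 0"
  using double_m_le m_pos by simp

lemma chord_subset: "t \<in> arcs 0 m \<Longrightarrow> chord t \<subseteq> {0..<int n}"
  using double_m_le m_pos by (cases t) auto

lemma mult_m_mod: "(i * m) mod int n = (i mod int d) * m"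
  by (simp add: n_eq mult_mod_left)

lemma turn_mod: "turn n (i * m) = turn n ((i mod int d) * m)"
  using rotate_vertex_cong[of "i * m" n "(i mod int d) * m"] by (simp add: mult_m_mod)

lemma rotate_other_sector:
  assumes "0 \<le> v" "v \<le> m" "0 < j" "j < int d"
  shows "rotate_vertex n (j * m) v \<in> insert 0 {m..}"
proof -
  have "j * m \<le> (int d - 1) * m" "m \<le> j * m" using assms m_pos by (auto intro!: mult_right_mono)
  then have "m \<le> v + j * m" "v + j * m \<le> int n" using assms by (auto simp: n_eq algebra_simps)
  then show ?thesis using m_pos by (cases "v + j * m = int n") (auto simp: rotate_vertex_def)
qed

lemma turn_other_sector:
  "t \<in> arcs 0 m \<Longrightarrow> 0 < j \<Longrightarrow> j < int d \<Longrightarrow> turn n (j * m) (chord t) \<subseteq> insert 0 {m..}"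
  using rotate_other_sector by (cases t) auto

lemma not_crosses_outside_sector:
  assumes "t \<in> arcs 0 m" "e \<subseteq> insert 0 {m..}"
  shows "\<not> crosses e (chord t)"
proof
  assume "crosses e (chord t)"
  then obtain p q r s where "p < q" "q < r" "r < s"
    "e = {p, r} \<and> chord t = {q, s} \<or> e = {q, s} \<and> chord t = {p, r}"
    unfolding crosses_def by blast
  moreover have "chord t \<subseteq> {0..m}" using assms(1) by (cases t) auto
  ultimately show False using assms(2) by auto
qed

lemma chord_outside_sector: "t \<in> arcs 0 m \<Longrightarrow> chord t \<subseteq> insert 0 {m..} \<Longrightarrow> t = (0, m)"
  by (cases t) auto

text \<open>If \<open>d = 2\<close>, the chord \<open>{0, m}\<close> is a diameter and belongs to both sectors.\<close>

lemma other_sector_chord_eqD: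
  assumes s_arc: "s \<in> arcs 0 m" and t_arc: "t \<in> arcs 0 m" and j_bounds: "0 < j" "j < int d"
    and turn_eq: "turn n (j * m) (chord s) = chord t"
  shows "d = 2" "t = (0, m)"
proof -
  show t_eq: "t = (0, m)"
    using turn_other_sector[OF s_arc j_bounds] turn_eq chord_outside_sector[OF t_arc] by simp
  have "chord s = turn n (- (j * m)) (chord t)"
    using turn_uminus_turn[OF chord_subset[OF s_arc], of "j * m"] turn_eq by simp
  also have "\<dots> = turn n ((int d - j) * m) (chord t)"
    using rotate_vertex_cong[of "- (j * m)" n "(int d - j) * m"]
    by (simp add: n_eq left_diff_distrib)
  finally have "s = (0, m)"
    using turn_other_sector[OF t_arc, of "int d - j"] j_bounds chord_outside_sector[OF s_arc]
    by simp
  then have corners: "{(j * m) mod int n, ((1 + j) * m) mod int n} = {0, m}"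
    using turn_eq by (simp add: t_eq rotate_vertex_def distrib_right)
  then have "j = 1" using j_bounds m_pos by (auto simp: mult_m_mod doubleton_eq_iff)
  then show "d = 2"
    using corners d_ge m_pos by (cases "d = 2") (auto simp: mult_m_mod doubleton_eq_iff)
qed

lemma turned_chords_shift:
  assumes "s \<in> arcs 0 m" "t \<in> arcs 0 m"
  shows "turn n (i * m) (chord s) = turn n (j * m) (chord t) \<longleftrightarrow>
      turn n ((i - j) mod int d * m) (chord s) = chord t"
    and "crosses (turn n (i * m) (chord s)) (turn n (j * m) (chord t)) \<longleftrightarrow>
      crosses (turn n ((i - j) mod int d * m) (chord s)) (chord t)"
proof -
  let ?s = "turn n ((i - j) mod int d * m) (chord s)"
  have turn_s: "turn n (i * m) (chord s) = turn n (j * m) ?s"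
    unfolding turn_mod[of "i - j", symmetric] turn_turn by (simp add: algebra_simps)
  have bounds: "?s \<subseteq> {0..<int n}" "chord t \<subseteq> {0..<int n}"
    using turn_subset[OF n_pos] chord_subset assms by auto
  show "turn n (i * m) (chord s) = turn n (j * m) (chord t) \<longleftrightarrow> ?s = chord t"
    unfolding turn_s using inj_on_eq_iff[OF inj_on_turn, of ?s n "chord t"] bounds by blast
  show "crosses (turn n (i * m) (chord s)) (turn n (j * m) (chord t)) \<longleftrightarrow> crosses ?s (chord t)"
    unfolding turn_s by (rule crosses_turn[OF n_pos bounds])
qed

lemma turned_chords_eqD:
  assumes st_arcs: "s \<in> arcs 0 m" "t \<in> arcs 0 m" and outer: "d = 2 \<Longrightarrow> t \<noteq> (0, m)"
    and turn_eq: "turn n (i * m) (chord s) = turn n (j * m) (chord t)"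
  shows "s = t" "i mod int d = j mod int d"
proof -
  let ?l = "(i - j) mod int d"
  have shifted: "turn n (?l * m) (chord s) = chord t"
    using turned_chords_shift(1)[OF st_arcs] turn_eq by blast
  have "?l = 0"
  proof (rule ccontr)
    assume "?l \<noteq> 0"
    moreover have "0 \<le> ?l" "?l < int d" using d_ge by auto
    ultimately show False using other_sector_chord_eqD[OF st_arcs _ _ shifted] outer by auto
  qed
  then show "i mod int d = j mod int d" by (simp add: mod_eq_dvd_iff dvd_eq_mod_eq_0)
  have "chord s = chord t" using shifted \<open>?l = 0\<close> turn_0[OF chord_subset[OF st_arcs(1)]] by simp
  then show "s = t" using inj_onD[OF inj_on_chord] st_arcs by blast
qed

lemma turned_chords_crossD:
  assumes st_arcs: "s \<in> arcs 0 m" "t \<in> arcs 0 m"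
    and "crosses (turn n (i * m) (chord s)) (turn n (j * m) (chord t))"
  shows "crossing s t \<or> crossing t s"
proof -
  let ?l = "(i - j) mod int d"
  have shifted: "crosses (turn n (?l * m) (chord s)) (chord t)"
    using turned_chords_shift(2)[OF st_arcs] assms(3) by blast
  have "?l = 0"
  proof (rule ccontr)
    assume "?l \<noteq> 0"
    moreover have "0 \<le> ?l" "?l < int d" using d_ge by auto
    ultimately show False
      using shifted
        not_crosses_outside_sector[OF st_arcs(2) turn_other_sector[OF st_arcs(1), of ?l]]
      by simp
  qed
  then have "crosses (chord s) (chord t)"
    using shifted turn_0[OF chord_subset[OF st_arcs(1)]] by simp
  then show ?thesis using crosses_chord[OF st_arcs] by blast
qed

definition spread :: "(int \<times> int) set \<Rightarrow> int set set" where
  "spread S = {turn n (j * m) (chord t) | j t. t \<in> S}"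

lemma spreadI: "t \<in> S \<Longrightarrow> e = turn n (j * m) (chord t) \<Longrightarrow> e \<in> spread S"
  unfolding spread_def by blast

lemma spreadE:
  assumes "e \<in> spread S"
  obtains j t where "t \<in> S" "e = turn n (j * m) (chord t)"
  using assms unfolding spread_def by blast

lemma spread_mono: "S \<subseteq> T \<Longrightarrow> spread S \<subseteq> spread T"
  unfolding spread_def by blast

lemma turn_spread: "turn n m ` spread S = spread S"
proof (intro equalityI subsetI)
  fix e assume "e \<in> turn n m ` spread S"
  then obtain j t where "t \<in> S" "e = turn n m (turn n (j * m) (chord t))" by (auto elim: spreadE)
  then show "e \<in> spread S"
    by (intro spreadI[of t S _ "j + 1"]) (simp_all add: turn_turn algebra_simps)
next
  fix e assume "e \<in> spread S"
  then obtain j t where sector_chord: "t \<in> S" "e = turn n (j * m) (chord t)" by (rule spreadE)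
  then have "e = turn n m (turn n ((j - 1) * m) (chord t))" by (simp add: turn_turn algebra_simps)
  then show "e \<in> turn n m ` spread S" using spreadI[OF sector_chord(1) refl] by blast
qed

lemma card_spread:
  assumes S_arcs: "S \<subseteq> arcs 0 m" and outer: "d = 2 \<Longrightarrow> (0, m) \<notin> S"
  shows "card (spread S) = d * card S"
proof -
  let ?f = "\<lambda>(j, t). turn n (j * m) (chord t)"
  have "spread S = ?f ` ({0..<int d} \<times> S)"
  proof (intro equalityI subsetI)
    fix e assume "e \<in> spread S"
    then obtain j t where "t \<in> S" "e = turn n (j * m) (chord t)" by (rule spreadE)
    then show "e \<in> ?f ` ({0..<int d} \<times> S)"
      using turn_mod[of j] d_ge by (intro image_eqI[of _ _ "(j mod int d, t)"]) auto
  qed (auto intro: spreadI)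
  moreover have "inj_on ?f ({0..<int d} \<times> S)"
  proof (rule inj_onI, clarify)
    fix i s j t
    assume indices: "i \<in> {0..<int d}" "j \<in> {0..<int d}" and members: "s \<in> S" "t \<in> S"
      and turn_eq: "turn n (i * m) (chord s) = turn n (j * m) (chord t)"
    have "s \<in> arcs 0 m" "t \<in> arcs 0 m" "d = 2 \<Longrightarrow> t \<noteq> (0, m)" using members S_arcs outer by blast+
    from turned_chords_eqD[OF this turn_eq] show "i = j \<and> s = t" using indices by simp
  qed
  ultimately show ?thesis by (simp add: card_image card_cartesian_product)
qed

lemma chord_mem_spread_iff:
  assumes "S \<subseteq> A" "A \<subseteq> arcs 0 m" "t \<in> A" and outer: "d = 2 \<Longrightarrow> (0, m) \<notin> A"
  shows "chord t \<in> spread S \<longleftrightarrow> t \<in> S"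
proof
  have turn_t: "chord t = turn n (0 * m) (chord t)"
    using turn_0[OF chord_subset[of t]] assms(2,3) by auto
  then show "chord t \<in> spread S" if "t \<in> S" using spreadI[OF that] by blast
  assume "chord t \<in> spread S"
  then obtain j s where s_mem: "s \<in> S" and "chord t = turn n (j * m) (chord s)" by (rule spreadE)
  then have "turn n (0 * m) (chord t) = turn n (j * m) (chord s)" using turn_t by simp
  then have "t = s" using turned_chords_eqD(1)[of t s 0 j] assms s_mem by blast
  then show "t \<in> S" using s_mem by simp
qed

lemma chord_in_diagonals: "t \<in> arcs 0 m - unit_arcs 0 m \<Longrightarrow> chord t \<in> diagonals n"
  using double_m_le m_pos by (cases t) (auto simp: pair_in_diagonals_iff)

lemma spread_dissection:
  assumes family: "S \<in> noncrossing_subsets A k" and sector: "A \<subseteq> arcs 0 m - unit_arcs 0 m"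
    and outer: "d = 2 \<Longrightarrow> (0, m) \<notin> A"
  shows "spread S \<in> dissections n (d * k)"
proof -
  have family: "S \<subseteq> A" "S \<subseteq> arcs 0 m" "noncrossing S" "card S = k"
    using family sector by (auto simp: noncrossing_subsets_def)
  have "spread S \<subseteq> diagonals n"
    using family(1) sector chord_in_diagonals rotate_diagonal[OF n_pos] by (blast elim: spreadE)
  moreover have "\<not> crosses e f" if "e \<in> spread S" "f \<in> spread S" for e f
    using that family(2,3) turned_chords_crossD unfolding noncrossing_def by (blast elim!: spreadE)
  moreover have "card (spread S) = d * k" using card_spread family outer by blast
  ultimately show ?thesis by (simp add: dissections_def)
qed

lemma turn_mult_invariant:
  assumes "turn n m ` D = D" "D \<subseteq> diagonals n" "e \<in> D"
  shows "turn n (j * m) e \<in> D"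
proof -
  have "turn n (int i * m) e \<in> D" for i
  proof (induction i)
    case 0
    show ?case using turn_0[OF diagonals_subset, of e n] assms(2,3) by auto
  next
    case (Suc i)
    have "turn n (int (Suc i) * m) e = turn n m (turn n (int i * m) e)"
      by (simp add: turn_turn algebra_simps)
    then show ?case using Suc assms(1) by blast
  qed
  from this[of "nat (j mod int d)"] show ?thesis using turn_mod[of j] d_ge by simp
qed

lemma spread_of_invariant:
  assumes invariant: "turn n m ` D = D" "D \<subseteq> diagonals n" "D \<subseteq> spread A" and A_arcs: "A \<subseteq> arcs 0 m"
  shows "spread {t \<in> A. chord t \<in> D} = D"
proof (intro equalityI subsetI)
  fix e assume "e \<in> spread {t \<in> A. chord t \<in> D}"
  then show "e \<in> D" using turn_mult_invariant[OF invariant(1,2)] by (auto elim: spreadE)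
next
  fix e assume e_mem: "e \<in> D"
  then obtain j t where sector_chord: "t \<in> A" "e = turn n (j * m) (chord t)"
    using invariant(3) by (blast elim: spreadE)
  then have "chord t = turn n (- j * m) e"
    using turn_uminus_turn[OF chord_subset, of t "j * m"] A_arcs by auto
  then show "e \<in> spread {t \<in> A. chord t \<in> D}"
    using sector_chord turn_mult_invariant[OF invariant(1,2) e_mem, of "- j"]
    by (intro spreadI[of t]) simp_all
qed

lemma card_spread_dissections:
  assumes sector: "A \<subseteq> arcs 0 m - unit_arcs 0 m" and outer: "d = 2 \<Longrightarrow> (0, m) \<notin> A"
  shows "card {D \<in> dissections n (d * k). turn n m ` D = D \<and> D \<subseteq> spread A} =
    card (noncrossing_subsets A k)" (is "card ?X = _")
proof -
  let ?sector = "\<lambda>D. {t \<in> A. chord t \<in> D}"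
  have A_arcs: "A \<subseteq> arcs 0 m" using sector by blast
  have spread_sector: "spread (?sector D) = D" if "D \<in> ?X" for D
    using that spread_of_invariant[OF _ _ _ A_arcs] by (auto dest: dissectionsD(1))
  have "bij_betw spread (noncrossing_subsets A k) ?X"
  proof (rule bij_betw_byWitness[where f' = ?sector])
    show "\<forall>S\<in>noncrossing_subsets A k. ?sector (spread S) = S"
      using chord_mem_spread_iff[OF _ A_arcs _ outer] by (auto simp: noncrossing_subsets_def)
    show "\<forall>D\<in>?X. spread (?sector D) = D" using spread_sector by blast
    show "spread ` noncrossing_subsets A k \<subseteq> ?X"
    proof (rule image_subsetI)
      fix S assume family: "S \<in> noncrossing_subsets A k"
      then have "spread S \<subseteq> spread A" by (intro spread_mono) (simp add: noncrossing_subsets_def)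
      then show "spread S \<in> ?X" using spread_dissection[OF family sector outer] turn_spread by simp
    qed
    show "?sector ` ?X \<subseteq> noncrossing_subsets A k"
    proof (rule image_subsetI)
      fix D assume D_mem: "D \<in> ?X"
      have sector_arcs: "?sector D \<subseteq> arcs 0 m" using A_arcs by blast
      have "noncrossing (?sector D)"
        using D_mem noncrossing_iff_not_crosses[OF sector_arcs] by (auto dest: dissectionsD(3))
      moreover have "d * card (?sector D) = d * k"
        using card_spread[OF sector_arcs] outer spread_sector[OF D_mem] D_mem
        by (auto dest: dissectionsD(2))
      ultimately show "?sector D \<in> noncrossing_subsets A k"
        using d_ge by (auto simp: noncrossing_subsets_def)
    qed
  qed
  then show ?thesis by (rule bij_betw_same_card[symmetric])
qed

lemma rotate_corner: "rotate_vertex n (j * m) (i * m) = (i + j) mod int d * m"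
  by (simp add: rotate_vertex_def mult_m_mod flip: distrib_right)

lemma corner_outside_sector: "i mod int d * m \<in> insert 0 {m..}"
proof (cases "i mod int d = 0")
  case False
  moreover have "0 \<le> i mod int d" using d_ge by simp
  ultimately have "1 * m \<le> i mod int d * m" using m_pos by (intro mult_right_mono) auto
  then show ?thesis by simp
qed simp

lemma spread_not_crosses_corner_chord:
  assumes "e \<in> spread S" "S \<subseteq> arcs 0 m" "0 \<le> q" "q < int d"
  shows "\<not> crosses e {0, q * m}"
proof -
  obtain j t where sector_chord: "t \<in> arcs 0 m" "e = turn n (j * m) (chord t)"
    using assms(1,2) by (blast elim: spreadE)
  let ?c = "turn n (- (j * m)) {0, q * m}"
  have "?c \<subseteq> insert 0 {m..}"
    using rotate_corner[of "- j" 0] rotate_corner[of "- j" q] corner_outside_sector by simp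
  then have "\<not> crosses ?c (chord t)" by (rule not_crosses_outside_sector[OF sector_chord(1)])
  moreover have "q * m < int n" using assms(4) m_pos by (simp add: n_eq)
  then have "turn n (j * m) ?c = {0, q * m}"
    using turn_uminus_turn[of "{0, q * m}" n "- (j * m)"] assms(3) m_pos n_pos
    by (simp only: minus_minus) simp
  ultimately show ?thesis
    using crosses_turn[OF n_pos turn_subset[OF n_pos] chord_subset[OF sector_chord(1)]]
      crosses_sym sector_chord(2) by metis
qed

lemma diameter_notin_spread:
  assumes "int d = 2 * q" "A \<subseteq> arcs 0 m" "d = 2 \<Longrightarrow> (0, m) \<notin> A"
  shows "{0, q * m} \<notin> spread A"
proof
  assume "{0, q * m} \<in> spread A"
  then obtain j t where sector_chord: "t \<in> A" "{0, q * m} = turn n (j * m) (chord t)"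
    by (rule spreadE)
  have "turn n (q * m) {0, q * m} = {0, q * m}"
    using rotate_corner[of q 0] rotate_corner[of q q] assms(1) d_ge by (auto simp: insert_commute)
  then have "turn n ((q + j) * m) (chord t) = turn n (j * m) (chord t)"
    by (simp only: sector_chord(2) turn_turn distrib_right)
  then have "(q + j) mod int d = j mod int d"
    using turned_chords_eqD(2)[of t t] assms(2,3) sector_chord(1) by blast
  then have "int d dvd q" by (simp add: mod_eq_dvd_iff)
  then show False using assms(1) d_ge zdvd_imp_le[of "int d" q] by simp
qed

end

section \<open>Dissections fixed by a rotation\<close>

definition fixed_dissections :: "nat \<Rightarrow> nat \<Rightarrow> int \<Rightarrow> int set set set" where
  "fixed_dissections n k g = {D \<in> dissections n k. turn n g ` D = D}"

lemma finite_fixed_dissections [simp]: "finite (fixed_dissections n k g)"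
  by (simp add: fixed_dissections_def)

lemma fixed_dissectionsD:
  assumes "D \<in> fixed_dissections n k g"
  shows "D \<in> dissections n k" "turn n g ` D = D" "D \<subseteq> diagonals n"
  using assms by (auto simp: fixed_dissections_def dest: dissectionsD(1))

lemma fixed_dissections_cong:
  "g mod int n = h mod int n \<Longrightarrow> fixed_dissections n k g = fixed_dissections n k h"
  using rotate_vertex_cong unfolding fixed_dissections_def by metis

lemma fixed_dissections_0: "fixed_dissections n k 0 = dissections n k"
proof -
  have "turn n 0 ` D = D" if "D \<in> dissections n k" for D
    using rotate_set_0[OF dissectionsD(1)[OF that]] .
  then show ?thesis unfolding fixed_dissections_def by blast
qed

lemma fixed_dissections_add:
  assumes "D \<in> fixed_dissections n k g" "D \<in> fixed_dissections n k h"
  shows "D \<in> fixed_dissections n k (g + h)"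
  using assms turn_image_turn_image[of n g h D] by (simp add: fixed_dissections_def)

lemma fixed_dissections_uminus: "fixed_dissections n k (- g) = fixed_dissections n k g"
proof -
  have "fixed_dissections n k g \<subseteq> fixed_dissections n k (- g)" for g
  proof
    fix D assume "D \<in> fixed_dissections n k g"
    note fixed = fixed_dissectionsD[OF this]
    then show "D \<in> fixed_dissections n k (- g)"
      using turn_uminus_image[OF fixed(3), of g] by (simp add: fixed_dissections_def)
  qed
  from this[of g] this[of "- g"] show ?thesis by simp
qed

lemma completions_fixed:
  assumes "n > 0" "D \<in> fixed_dissections n k g"
  shows "turn n g ` completions n D = completions n D"
  using completions_turn[OF assms(1), of D g] fixed_dissectionsD(2,3)[OF assms(2)] by simp

lemma turn_fixed_dissections:
  assumes "n > 0" "D \<in> fixed_dissections n k g"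
  shows "turn n j ` D \<in> fixed_dissections n k g"
proof -
  note fixed = fixed_dissectionsD[OF assms(2)]
  have "turn n g ` turn n j ` D = turn n j ` turn n g ` D"
    by (simp only: turn_image_turn_image add.commute)
  then show ?thesis
    using turn_dissection[OF assms(1) fixed(1)] fixed(2) by (simp add: fixed_dissections_def)
qed

lemma card_fixed_turn_completion:
  assumes n_pos: "n > 0" and e_vertices: "e \<subseteq> {0..<int n}"
  shows "card {D \<in> fixed_dissections n k g. turn n j e \<in> completions n D} =
    card {D \<in> fixed_dissections n k g. e \<in> completions n D}"
    (is "card (?F (turn n j e)) = card (?F e)")
proof -
  have turn_fixed_completion: "turn n i ` D \<in> ?F (turn n i c)" if "D \<in> ?F c" for i c D
    using that turn_fixed_dissections[OF n_pos, of D k g i]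
      turn_completion[OF n_pos fixed_dissectionsD(3), of D k g c i] by simp
  have "bij_betw (image (turn n j)) (?F e) (?F (turn n j e))"
  proof (rule bij_betw_byWitness[where f' = "image (turn n (- j))"])
    show "\<forall>D\<in>?F e. turn n (- j) ` turn n j ` D = D"
      using turn_uminus_image[OF fixed_dissectionsD(3), of _ n k g j] by simp
    show "\<forall>D\<in>?F (turn n j e). turn n j ` turn n (- j) ` D = D"
      using turn_uminus_image[OF fixed_dissectionsD(3), of _ n k g "- j"] by simp
    show "image (turn n j) ` ?F e \<subseteq> ?F (turn n j e)"
      using turn_fixed_completion by (rule image_subsetI)
    have "turn n (- j) ` D \<in> ?F e" if "D \<in> ?F (turn n j e)" for D
      using turn_fixed_completion[OF that, of "- j"] unfolding turn_uminus_turn[OF e_vertices] .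
    then show "image (turn n (- j)) ` ?F (turn n j e) \<subseteq> ?F e" by (rule image_subsetI)
  qed
  then show ?thesis by (rule bij_betw_same_card[symmetric])
qed

text \<open>A rotation fixing an almost-triangulation permutes the corners of its quadrilateral. Comparing
  the sums of the corners modulo \<open>n\<close> shows that its fourth power is trivial.\<close>

lemma fixed_almost_triangulation_dvd:
  assumes n_ge: "n \<ge> 4" and fixed: "D \<in> fixed_dissections n (n - 4) g"
  shows "int n dvd 4 * g"
proof -
  obtain p q r s where pqrs: "0 \<le> p" "p < q" "q < r" "r < s" "s < int n"
    and completions: "completions n D = {{p, r}, {q, s}}"
    using completions_almost_triangulation[OF n_ge fixed_dissectionsD(1)[OF fixed]] .
  define corners where "corners = \<Union> (completions n D)"
  have "rotate_vertex n g ` corners = corners"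
    using completions_fixed[OF _ fixed] n_ge unfolding corners_def image_Union by simp
  moreover have corners: "corners = {p, q, r, s}" by (auto simp: corners_def completions)
  moreover have "inj_on (rotate_vertex n g) corners"
    using rotate_vertex_inj[of n] n_ge pqrs by (intro inj_onI) (auto simp: corners)
  ultimately have "(\<Sum>v\<in>corners. v) = (\<Sum>v\<in>corners. (v + g) mod int n)"
    using sum.reindex[of "rotate_vertex n g" corners "\<lambda>v. v"] by (simp add: rotate_vertex_def)
  then have "(\<Sum>v\<in>corners. v) mod int n = (\<Sum>v\<in>corners. v + g) mod int n"
    by (simp add: mod_sum_eq)
  also have "(\<Sum>v\<in>corners. v + g) = (\<Sum>v\<in>corners. v) + 4 * g"
    using pqrs by (simp add: corners)
  finally show ?thesis by (simp add: mod_eq_dvd_iff)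
qed

lemma antipodal_quadruple:
  fixes h :: int
  assumes "h > 0" and pqrs: "0 \<le> p" "p < q" "q < r" "r < s" "s < 2 * h"
    and antipode: "\<And>v. v \<in> {p, q, r, s} \<Longrightarrow> (if v < h then v + h else v - h) \<in> {p, q, r, s}"
  shows "q < h" "r = p + h" "s = q + h"
proof -
  have "p < h" using antipode[of p] pqrs \<open>h > 0\<close> by (auto split: if_splits)
  show "q < h"
  proof (rule ccontr)
    assume "\<not> q < h"
    then show False using antipode[of q] antipode[of r] antipode[of s] pqrs \<open>h > 0\<close>
      by (auto split: if_splits)
  qed
  have "h \<le> r"
  proof (rule ccontr)
    assume "\<not> h \<le> r"
    then show False using antipode[of p] antipode[of q] antipode[of r] pqrs \<open>h > 0\<close>
      by (auto split: if_splits)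
  qed
  then show "r = p + h" "s = q + h"
    using antipode[of p] antipode[of q] \<open>p < h\<close> \<open>q < h\<close> pqrs by (auto split: if_splits)
qed

lemma completions_half_turn:
  assumes n_ge: "n \<ge> 4" and n_double: "int n = 2 * h" and fixed: "D \<in> fixed_dissections n (n - 4) h"
  obtains p q where "0 \<le> p" "p < q" "q < h" "completions n D = {{p, p + h}, {q, q + h}}"
proof -
  obtain p q r s where pqrs: "0 \<le> p" "p < q" "q < r" "r < s" "s < 2 * h"
    and completions: "completions n D = {{p, r}, {q, s}}"
    using completions_almost_triangulation[OF n_ge fixed_dissectionsD(1)[OF fixed]] n_double
    by metis
  have "\<Union> (completions n D) = {p, q, r, s}" by (auto simp: completions)
  moreover have "rotate_vertex n h ` \<Union> (completions n D) = \<Union> (completions n D)"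
    using completions_fixed[OF _ fixed] n_ge unfolding image_Union by simp
  ultimately have rotate_corners: "rotate_vertex n h ` {p, q, r, s} = {p, q, r, s}" by simp
  have "h > 0" using n_ge n_double by simp
  moreover have "(if v < h then v + h else v - h) \<in> {p, q, r, s}" if "v \<in> {p, q, r, s}" for v
  proof -
    have "v \<in> {0..<int n}" using that pqrs n_double by auto
    then have "rotate_vertex n h v = (if v < h then v + h else v - h)"
      using rotate_vertex_cases[of v n h] n_double \<open>h > 0\<close> by auto
    then show ?thesis using rotate_corners that by (metis image_eqI)
  qed
  ultimately have "q < h" "r = p + h" "s = q + h" using antipodal_quadruple[OF _ pqrs] by blast+
  then show thesis using that pqrs(1,2) completions by simp
qed

lemma double_card_fixed_dissections:
  assumes n_ge: "n \<ge> 4" and n_double: "int n = 2 * h"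
    and subset: "fixed_dissections n (n - 4) g \<subseteq> fixed_dissections n (n - 4) h"
  shows "2 * card (fixed_dissections n (n - 4) g) =
    nat h * card {D \<in> fixed_dissections n (n - 4) g. {0, h} \<in> completions n D}"
proof -
  let ?F = "fixed_dissections n (n - 4) g"
  let ?diameter = "\<lambda>D v. {v, v + h} \<in> completions n D"
  have "card {v \<in> {0..<h}. ?diameter D v} = 2" if fixed: "D \<in> ?F" for D
  proof -
    obtain p q where "0 \<le> p" "p < q" "q < h" "completions n D = {{p, p + h}, {q, q + h}}"
      using completions_half_turn[OF n_ge n_double subsetD[OF subset fixed]] .
    moreover from this have "{v \<in> {0..<h}. ?diameter D v} = {p, q}" by (auto simp: doubleton_eq_iff)
    ultimately show ?thesis by simp
  qed
  moreover have "card {D \<in> ?F. ?diameter D v} = card {D \<in> ?F. {0, h} \<in> completions n D}"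
    if "v \<in> {0..<h}" for v
  proof -
    have "turn n v {0, h} = {v, v + h}"
      using that n_double by (simp add: rotate_vertex_def add.commute)
    then show ?thesis
      using card_fixed_turn_completion[of n "{0, h}" "n - 4" g v] n_ge n_double by simp
  qed
  ultimately have "(\<Sum>D\<in>?F. 2) = card {D \<in> ?F. {0, h} \<in> completions n D} * card {0..<h}"
    using sum_multicount[of ?F "{0..<h}" "\<lambda>D v. ?diameter D v"] by simp
  then show ?thesis by (simp add: mult.commute)
qed

lemma card_fixed_dissections_eq_catalan:
  assumes n_ge: "n \<ge> 4" and n_double: "int n = 2 * h" and b_pos: "b > 0"
    and subset: "fixed_dissections n (n - 4) g \<subseteq> fixed_dissections n (n - 4) h"
    and diameter: "card {D \<in> fixed_dissections n (n - 4) g. {0, h} \<in> completions n D} =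
      card (triangulations 0 b)"
  shows "real (card (fixed_dissections n (n - 4) g)) = real n / 4 * catalan (of_int b - 1)"
proof -
  have "2 * card (fixed_dissections n (n - 4) g) = nat h * card (triangulations 0 b)"
    using double_card_fixed_dissections[OF n_ge n_double subset] diameter by simp
  then have "2 * real (card (fixed_dissections n (n - 4) g)) =
      real (nat h) * real (card (triangulations 0 b))"
    by (metis of_nat_mult of_nat_numeral)
  moreover have "real (nat h) = real n / 2"
    using arg_cong[OF n_double, of real_of_int] n_ge n_double by simp
  moreover have "real (card (triangulations 0 b)) = catalan (of_int b - 1)"
    using card_triangulations[of 0 "nat (b - 1)"] b_pos by simp
  ultimately show ?thesis by simp
qed

context sectors
begin

lemma spread_diagonalI:
  assumes "0 \<le> x" "j * m \<le> x" "x < y" "y < int n" and "(x - j * m, y - j * m) \<in> A"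
  shows "{x, y} \<in> spread A"
  using assms by (intro spreadI[OF assms(5), of _ j]) (simp add: rotate_vertex_def)

lemma spread_wrapping_diagonalI:
  assumes "0 \<le> y" "y < int n" and "(y - (int d - 1) * m, m) \<in> A"
  shows "{0, y} \<in> spread A"
  using assms by (intro spreadI[OF assms(3), of _ "int d - 1"])
    (simp add: rotate_vertex_def n_eq insert_commute algebra_simps)

lemma card_fixed_diameter:
  assumes d_even: "int d = 2 * q" and n_decomposition: "n = d * k + 4"
    and sector: "A \<subseteq> arcs 0 m - unit_arcs 0 m" "d = 2 \<Longrightarrow> (0, m) \<notin> A"
    and spread_covers: "\<And>e. e \<in> diagonals n \<Longrightarrow>
      (\<And>j. e \<noteq> turn n (j * m) {0, q * m} \<and> \<not> crosses e (turn n (j * m) {0, q * m})) \<Longrightarrow> e \<in> spread A"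
  shows "card {D \<in> fixed_dissections n (n - 4) m. {0, q * m} \<in> completions n D} =
    card (noncrossing_subsets A k)"
proof -
  let ?c = "{0, q * m}"
  have "int n = 2 * (q * m)" using n_eq d_even by simp
  moreover have "int n \<ge> 4" by (simp add: n_decomposition)
  ultimately have "2 \<le> q * m" "q * m + 2 \<le> int n" by linarith+
  then have diameter: "?c \<in> diagonals n" using pair_in_diagonals_iff[of 0 "q * m" n] by simp
  have "D \<subseteq> spread A"
    if fixed: "D \<in> fixed_dissections n (n - 4) m" and addable_diameter: "?c \<in> completions n D" for D
  proof
    fix e assume e_mem: "e \<in> D"
    have "turn n (j * m) ?c \<in> completions n D" for j
      using turn_mult_invariant[OF completions_fixed[OF n_pos fixed] _ addable_diameter]
      by (auto simp: completions_def)
    then have "e \<noteq> turn n (j * m) ?c \<and> \<not> crosses e (turn n (j * m) ?c)" for j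
      using e_mem unfolding completions_def by blast
    then show "e \<in> spread A" using spread_covers e_mem fixed_dissectionsD(3)[OF fixed] by blast
  qed
  moreover have "?c \<in> completions n D" if "D \<subseteq> spread A" for D
  proof -
    have "0 \<le> q" "q < int d" using d_even d_ge by simp_all
    then show ?thesis
      using that diameter sector(1)
        spread_not_crosses_corner_chord[of _ A q] diameter_notin_spread[OF d_even _ sector(2)]
      unfolding completions_def by blast
  qed
  ultimately have "{D \<in> fixed_dissections n (n - 4) m. ?c \<in> completions n D} =
      {D \<in> dissections n (d * k). turn n m ` D = D \<and> D \<subseteq> spread A}"
    unfolding fixed_dissections_def n_decomposition by auto
  then show ?thesis using card_spread_dissections[OF sector] by simp
qed

lemma diagonal_in_two_sectors:
  assumes "d = 2" "e \<in> diagonals n" "e \<noteq> {0, m}" "\<not> crosses e {0, m}"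
  shows "e \<in> spread (inner_arcs 0 m)"
proof -
  have n_double: "int n = 2 * m" using n_eq assms(1) by simp
  from assms(2) obtain x y
    where endpoints: "e = {x, y}" "0 \<le> x" "x + 1 < y" "y < int n" "(x, y) \<noteq> (0, int n - 1)"
    by (rule diagonal_cases)
  have not_diameter: "(x, y) \<noteq> (0, m)" and "\<not> (0 < x \<and> x < m \<and> m < y)"
    using crossesI[of 0 x m y] crosses_sym endpoints(1) assms(3,4) by auto
  then consider (first) "y \<le> m" | (second) "m \<le> x" | (wrapping) "x = 0" "m < y"
    using endpoints(2) by linarith
  then show ?thesis
  proof cases
    case first
    then have "(x - 0 * m, y - 0 * m) \<in> inner_arcs 0 m" using endpoints(2-) not_diameter by simp
    then show ?thesis using spread_diagonalI[of x 0 y] endpoints by simp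
  next
    case second
    then have "(x - 1 * m, y - 1 * m) \<in> inner_arcs 0 m" using endpoints(2-) n_double by auto
    then show ?thesis using spread_diagonalI[of x 1 y] endpoints second by simp
  next
    case wrapping
    then have "(y - (int d - 1) * m, m) \<in> inner_arcs 0 m"
      using endpoints(2-) n_double assms(1) by auto
    then show ?thesis using spread_wrapping_diagonalI[of y] endpoints wrapping by simp
  qed
qed

lemma diagonal_in_four_sectors:
  assumes "d = 4" "e \<in> diagonals n" "\<not> crosses e {0, 2 * m}" "\<not> crosses e {m, 3 * m}"
  shows "e \<in> spread (arcs 0 m - unit_arcs 0 m)"
proof -
  let ?A = "arcs 0 m - unit_arcs 0 m"
  have n_quadruple: "int n = 4 * m" using n_eq assms(1) by simp
  from assms(2) obtain x y
    where endpoints: "e = {x, y}" "0 \<le> x" "x + 1 < y" "y < int n" "(x, y) \<noteq> (0, int n - 1)"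
    by (rule diagonal_cases)
  have uncrossed: "\<not> (0 < x \<and> x < 2 * m \<and> 2 * m < y)" "\<not> (m < x \<and> x < 3 * m \<and> 3 * m < y)"
    "\<not> (x < m \<and> m < y \<and> y < 3 * m)"
    using crossesI[of 0 x "2 * m" y] crossesI[of m x "3 * m" y] crossesI[of x m y "3 * m"]
      crosses_sym endpoints(1) assms(3,4) by auto
  have inside: "e \<in> spread ?A" if "j * m \<le> x" "y \<le> (j + 1) * m" for j
  proof -
    have "(x - j * m, y - j * m) \<in> ?A" using endpoints(3) that by (simp add: distrib_right)
    then show ?thesis using spread_diagonalI[of x j y ?A] endpoints that(1) by simp
  qed
  consider (first) "x < m" "y \<le> m" | (wrapping) "x < m" "m < y" | (second) "m \<le> x" "x < 2 * m"
    | (third) "2 * m \<le> x" "x < 3 * m" | (fourth) "3 * m \<le> x" by linarith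
  then show ?thesis
  proof cases
    case first
    then show ?thesis using inside[of 0] endpoints(2) by simp
  next
    case second
    then show ?thesis using inside[of 1] uncrossed(1) m_pos by simp
  next
    case third
    then show ?thesis using inside[of 2] uncrossed(2) m_pos by simp
  next
    case fourth
    then show ?thesis using inside[of 3] endpoints(4) n_quadruple by simp
  next
    case wrapping
    then have "x = 0" "3 * m \<le> y" using uncrossed(1,3) endpoints(2) m_pos by auto
    moreover from this have "(y - (int d - 1) * m, m) \<in> ?A"
      using endpoints(4,5) n_quadruple assms(1) by auto
    ultimately show ?thesis using spread_wrapping_diagonalI[of y ?A] endpoints(1,4) m_pos by simp
  qed
qed

end

lemma card_fixed_half_turn:
  assumes n_ge: "n \<ge> 4" and n_double: "int n = 2 * h"
  shows "real (card (fixed_dissections n (n - 4) h)) = real n / 4 * catalan (real n / 2 - 1)"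
proof -
  interpret sectors n 2 h using n_ge n_double by unfold_locales auto
  have "turn n (0 * h) {0, 1 * h} = {0, h}" using n_double m_pos by (simp add: rotate_vertex_def)
  then have "e \<in> spread (inner_arcs 0 h)"
    if "e \<in> diagonals n"
      "\<And>j. e \<noteq> turn n (j * h) {0, 1 * h} \<and> \<not> crosses e (turn n (j * h) {0, 1 * h})" for e
    using diagonal_in_two_sectors that(1) that(2)[of 0] by simp
  then have "card {D \<in> fixed_dissections n (n - 4) h. {0, 1 * h} \<in> completions n D} =
      card (noncrossing_subsets (inner_arcs 0 h) (nat (h - 2)))"
    using n_ge n_double by (intro card_fixed_diameter) (auto simp: inner_arcs_def sides_def)
  also have "\<dots> = card (triangulations 0 h)"
    using card_noncrossing_inner_arcs[of 0 h] n_ge n_double by simp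
  finally have "real (card (fixed_dissections n (n - 4) h)) = real n / 4 * catalan (of_int h - 1)"
    using n_ge n_double m_pos by (intro card_fixed_dissections_eq_catalan) simp_all
  moreover have "real n / 2 = of_int h" using arg_cong[OF n_double, of real_of_int] by simp
  ultimately show ?thesis by simp
qed

lemma card_fixed_quarter_turn:
  assumes n_ge: "n \<ge> 4" and n_quadruple: "int n = 4 * m"
  shows "real (card (fixed_dissections n (n - 4) m)) = real n / 4 * catalan (real n / 4 - 1)"
proof -
  interpret sectors n 4 m using n_ge n_quadruple by unfold_locales auto
  let ?A = "arcs 0 m - unit_arcs 0 m"
  have "turn n (0 * m) {0, 2 * m} = {0, 2 * m}" "turn n (1 * m) {0, 2 * m} = {m, 3 * m}"
    using n_quadruple m_pos by (simp_all add: rotate_vertex_def)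
  then have "e \<in> spread ?A"
    if "e \<in> diagonals n"
      "\<And>j. e \<noteq> turn n (j * m) {0, 2 * m} \<and> \<not> crosses e (turn n (j * m) {0, 2 * m})" for e
    using diagonal_in_four_sectors that(1) that(2)[of 0] that(2)[of 1] by simp
  then have "card {D \<in> fixed_dissections n (n - 4) m. {0, 2 * m} \<in> completions n D} =
      card (noncrossing_subsets ?A (nat (m - 1)))"
    using n_ge n_quadruple by (intro card_fixed_diameter) auto
  also have "\<dots> = card (triangulations 0 m)"
    using m_pos by (intro card_noncrossing_subsets_maximal) (auto simp: sides_def card_unit_arcs)
  moreover have "fixed_dissections n (n - 4) m \<subseteq> fixed_dissections n (n - 4) (2 * m)"
    using fixed_dissections_add[of _ n _ m m] by auto
  ultimately have "real (card (fixed_dissections n (n - 4) m)) =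
      real n / 4 * catalan (of_int m - 1)"
    using n_ge n_quadruple m_pos by (intro card_fixed_dissections_eq_catalan) simp_all
  moreover have "real n / 4 = of_int m" using arg_cong[OF n_quadruple, of real_of_int] by simp
  ultimately show ?thesis by simp
qed

section \<open>Counting orbits\<close>

lemma catalan_eq_0_if_not_dvd:
  assumes "c > 0" "\<not> c dvd n"
  shows "catalan (real n / real c - 1) = 0"
proof -
  have "real n / real c - 1 \<notin> \<nat>"
  proof
    assume "real n / real c - 1 \<in> \<nat>"
    then obtain k where "real n / real c - 1 = real k" by (auto simp: Nats_def)
    then have "real n = real (c * (k + 1))" using assms(1) by (simp add: field_simps)
    then have "n = c * (k + 1)" by (simp only: of_nat_eq_iff)
    then show False using assms(2) by simp
  qed
  then show ?thesis by (simp add: catalan_def)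
qed

lemma sum_over_fractions_of_turn:
  fixes f :: "int \<Rightarrow> 'a::comm_monoid_add"
  assumes "n > 0" "k > 0" "\<And>g. \<not> n dvd k * g \<Longrightarrow> f g = 0"
  shows "(\<Sum>g\<in>{0..<n}. f g) = (\<Sum>c\<in>{0..<k}. if k dvd c * n then f (c * n div k) else 0)"
proof -
  have bounds: "g \<in> {0..<n} \<longleftrightarrow> c \<in> {0..<k}" if "k * g = c * n" for g c
  proof -
    have "0 \<le> g \<longleftrightarrow> 0 \<le> c * n" "g < n \<longleftrightarrow> c * n < k * n"
      using assms(2) by (simp_all add: zero_le_mult_iff flip: that)
    then show ?thesis using assms(1) by (simp add: zero_le_mult_iff)
  qed
  have "(\<Sum>g\<in>{0..<n}. f g) = (\<Sum>g\<in>{g\<in>{0..<n}. n dvd k * g}. f g)"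
    using assms(3) by (intro sum.mono_neutral_right) auto
  also have "\<dots> = (\<Sum>c\<in>{c\<in>{0..<k}. k dvd c * n}. f (c * n div k))"
  proof (rule sum.reindex_bij_witness[of _ "\<lambda>c. c * n div k" "\<lambda>g. k * g div n"])
    fix g assume g_multiple: "g \<in> {g\<in>{0..<n}. n dvd k * g}"
    then have multiple: "k * g = (k * g div n) * n" by simp
    then show "(k * g div n) * n div k = g" using assms(2) by simp
    then show "f ((k * g div n) * n div k) = f g" by simp
    show "k * g div n \<in> {c\<in>{0..<k}. k dvd c * n}"
      using bounds[OF multiple] g_multiple multiple[symmetric] by simp
  next
    fix c assume c_multiple: "c \<in> {c\<in>{0..<k}. k dvd c * n}"
    then have multiple: "k * (c * n div k) = c * n" by simp
    then show "k * (c * n div k) div n = c" using assms(1) by simp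
    show "c * n div k \<in> {g\<in>{0..<n}. n dvd k * g}"
      using bounds[OF multiple] c_multiple multiple by simp
  qed
  also have "\<dots> = (\<Sum>c\<in>{0..<k}. if k dvd c * n then f (c * n div k) else 0)"
    by (rule sum.inter_filter) simp
  finally show ?thesis .
qed

text \<open>A shift by \<open>c * int n div 4\<close> is the rotation by \<open>c\<close> right angles, if the polygon admits it.\<close>

definition card_fixed_quarters :: "nat \<Rightarrow> int \<Rightarrow> real" where
  "card_fixed_quarters n c =
    (if 4 dvd c * int n then real (card (fixed_dissections n (n - 4) (c * int n div 4))) else 0)"

lemma card_fixed_quarters_0: "card_fixed_quarters n 0 = real (card (dissections n (n - 4)))"
  by (simp add: card_fixed_quarters_def fixed_dissections_0)

lemma card_fixed_quarters_1:
  assumes "n \<ge> 4"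
  shows "card_fixed_quarters n 1 = real n / 4 * catalan (real n / 4 - 1)"
proof (cases "4 dvd n")
  case True
  then have "4 dvd int n" "int n = 4 * (int n div 4)" by presburger+
  then show ?thesis using card_fixed_quarter_turn[OF assms] by (simp add: card_fixed_quarters_def)
next
  case False
  then have "\<not> 4 dvd int n" by presburger
  then show ?thesis
    using catalan_eq_0_if_not_dvd[of 4 n] False by (simp add: card_fixed_quarters_def)
qed

lemma card_fixed_quarters_2:
  assumes "n \<ge> 4"
  shows "card_fixed_quarters n 2 = real n / 4 * catalan (real n / 2 - 1)"
proof (cases "even n")
  case True
  then have "4 dvd 2 * int n" "int n = 2 * (2 * int n div 4)" by presburger+
  then show ?thesis using card_fixed_half_turn[OF assms] by (simp add: card_fixed_quarters_def)
next
  case False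
  then have "\<not> 4 dvd 2 * int n" by presburger
  then show ?thesis
    using catalan_eq_0_if_not_dvd[of 2 n] False by (simp add: card_fixed_quarters_def)
qed

lemma card_fixed_quarters_3: "card_fixed_quarters n 3 = card_fixed_quarters n 1"
proof (cases "4 dvd int n")
  case True
  then have quarter: "int n = 4 * (int n div 4)" "3 * int n div 4 = 3 * (int n div 4)"
    by presburger+
  then have "(3 * (int n div 4)) mod int n = (- (int n div 4)) mod int n"
    unfolding mod_eq_dvd_iff by simp
  then have "fixed_dissections n k (3 * (int n div 4)) = fixed_dissections n k (int n div 4)" for k
    using fixed_dissections_cong fixed_dissections_uminus by metis
  then show ?thesis using True quarter(2) by (simp add: card_fixed_quarters_def)
next
  case False
  then have "\<not> 4 dvd 3 * int n" by presburger
  then show ?thesis using False by (simp add: card_fixed_quarters_def)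
qed

lemma sum_card_fixed_almost_triangulations:
  assumes "n \<ge> 4"
  shows "(\<Sum>g\<in>{0..<int n}. real (card (fixed_dissections n (n - 4) g))) =
    real (card (dissections n (n - 4))) + real n / 4 * catalan (real n / 2 - 1)
      + real n / 2 * catalan (real n / 4 - 1)"
proof -
  have "fixed_dissections n (n - 4) g = {}" if "\<not> int n dvd 4 * g" for g
    using fixed_almost_triangulation_dvd[OF assms] that by blast
  then have "(\<Sum>g\<in>{0..<int n}. real (card (fixed_dissections n (n - 4) g))) =
      (\<Sum>c\<in>{0..<4}. card_fixed_quarters n c)"
    unfolding card_fixed_quarters_def using assms by (intro sum_over_fractions_of_turn) simp_all
  also have "{0..<4} = {0, 1, 2, 3 :: int}" by auto
  finally show ?thesis
    using assms by (simp add: card_fixed_quarters_0 card_fixed_quarters_1 card_fixed_quarters_2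
        card_fixed_quarters_3)
qed

theorem theorem2:
  fixes n :: nat
  assumes "n \<ge> 4"
  shows "real (card (dissection_classes n (n - 4))) =
    (real n - 3) / (2 * real n) * catalan (real n - 2)
      + 1 / 2 * catalan (real n / 4 - 1) + 1 / 4 * catalan (real n / 2 - 1)"
proof -
  let ?G = "integer_mod_group n" and ?E = "dissections n (n - 4)"
  interpret group_action ?G ?E "rotation n (n - 4)"
    using assms by (intro rotation_group_action) simp
  have carrier: "carrier ?G = {0..<int n}" using assms by (simp add: carrier_integer_mod_group)
  have invariants: "invariants ?E (rotation n (n - 4)) g = fixed_dissections n (n - 4) g" for g
    by (auto simp: invariants_def fixed_dissections_def rotation_def)
  have "card (dissection_classes n (n - 4)) * n =
      (\<Sum>g\<in>{0..<int n}. card (fixed_dissections n (n - 4) g))"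
    using burnside assms
    unfolding invariants by (simp add: dissection_classes_def order_def carrier)
  then have "real (card (dissection_classes n (n - 4))) * real n =
      (\<Sum>g\<in>{0..<int n}. real (card (fixed_dissections n (n - 4) g)))"
    by (metis of_nat_mult of_nat_sum)
  also have "\<dots> = (real n - 3) * catalan (real n - 2) / 2 + real n / 4 * catalan (real n / 2 - 1)
      + real n / 2 * catalan (real n / 4 - 1)"
    using sum_card_fixed_almost_triangulations[OF assms] card_almost_triangulations[OF assms]
    by simp
  finally show ?thesis using assms by (simp add: field_simps)
qed

end
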